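(* Suppose that $\varphi:[0,\infty)\to\mathbb{R}$ is a continuous function with $\varphi(0)=1$, $\lim_{t\to\infty}\varphi(t)=0$ and a continuous derivative $\varphi'$ on $(0,\infty)$ such that $-\varphi'(t^{1/2})$ is convex as a function of $t>0$. Then the restriction $\psi=\varphi|_{[0,\pi]}$ of $\varphi$ to the interval $[0,\pi]$ belongs to the class $\Psi_3^+$.
   Context: Let $\mathbb{S}^d=\{x\in\mathbb{R}^{d+1}:\|x\|=1\}$ and let $\theta(x,y)=\arccos(\langle x,y\rangle)\in[0,\pi]$ be the great circle distance on $\mathbb{S}^d$. A function $h:\mathbb{S}^d\times\mathbb{S}^d\to\mathbb{R}$ is strictly positive definite if $\sum_{i=1}^n\sum_{j=1}^n c_i c_j h(x_i,x_j)\ge 0$ for all finite systems of pairwise distinct points $x_1,\ldots,x_n\in\mathbb{S}^d$ and all $c_1,\ldots,c_n\in\mathbb{R}$, with strict inequality unless $c_1=\cdots=c_n=0$. For an integer $d\ge 1$, the class $\Psi_d^+$ consists of the continuous functions $\psi:[0,\pi]\to\mathbb{R}$ with $\psi(0)=1$ such that $h(x,y)=\psi(\theta(x,y))$ is strictly positive definite on $\mathbb{S}^d$. *)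

theory Defs
  imports "HOL-Analysis.Analysis"
begin

definition great_circle_dist :: "'a::euclidean_space \<Rightarrow> 'a \<Rightarrow> real" where
  "great_circle_dist x y = arccos (x \<bullet> y)"

definition strictly_positive_definite_on :: "'a set \<Rightarrow> ('a \<Rightarrow> 'a \<Rightarrow> real) \<Rightarrow> bool" where
  "strictly_positive_definite_on S h \<longleftrightarrow>
     (\<forall>(n::nat) x c. x ` {1..n} \<subseteq> S \<and> inj_on x {1..n} \<longrightarrow>
        (\<Sum>i=1..n. \<Sum>j=1..n. c i * c j * h (x i) (x j)) \<ge> 0 \<and>
        ((\<exists>i\<in>{1..n}. c i \<noteq> 0) \<longrightarrow>
          (\<Sum>i=1..n. \<Sum>j=1..n. c i * c j * h (x i) (x j)) > 0))"

text \<open>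
  The class \<open>\<Psi>\<^sub>d\<^sup>+\<close> is indexed by the ambient Euclidean space of the sphere, of dimension
  \<open>d + 1\<close>; the case \<open>d = 3\<close> is \<open>Psi_plus TYPE(real ^ 4)\<close>.  Functions with domain \<open>[0, \<pi>]\<close>
  are represented as extensional functions.
\<close>

definition Psi_plus :: "'a::euclidean_space itself \<Rightarrow> (real \<Rightarrow> real) set" where
  "Psi_plus _ =
     {\<psi> \<in> extensional {0..pi}. continuous_on {0..pi} \<psi> \<and> \<psi> 0 = 1 \<and>
        strictly_positive_definite_on (sphere (0::'a) 1) (\<lambda>x y. \<psi> (great_circle_dist x y))}"

end

theory Submission
  imports Defs
begin

text \<open>
  The volume of the intersection of two caps of radius \<open>r\<close> in the three-sphere is, up to a constant
  factor, a function \<open>V\<^sub>r\<close> of the distance \<open>\<theta>\<close> of their centres with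
  \<open>V\<^sub>r'(\<theta>) = - cos\<^sup>2 r (tan\<^sup>2 r - tan\<^sup>2 (\<theta>/2))\<^sub>+\<close>.
  Its expansion in the functions \<open>U\<^sub>n (cos \<theta>)\<close> has the nonnegative coefficients
  \<open>K\<^sub>n(r)\<^sup>2 / (n + 1)\<close>, and \<open>U\<^sub>n (x \<bullet> y)\<close> is positive definite, being the character of
  the \<open>n\<close>-th symmetric power of the standard representation of SU(2).  So \<open>V\<^sub>r\<close> is positive definite.

  In the variable \<open>u = tan\<^sup>2 (\<theta>/2)\<close> one has \<open>- \<phi>'(\<theta>) = G u\<close> with \<open>G = g \<circ> F\<close>,
  where \<open>g t = - \<phi>' (sqrt t)\<close> is convex and nonincreasing and
  \<open>F u = (2 arctan (sqrt u))\<^sup>2\<close> is strictly concave; hence \<open>G\<close> is convex.  Piecewise affine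
  interpolation approximates \<open>G\<close> by a constant plus nonnegative combinations of the hinges \<open>(a - u)\<^sub>+\<close>,
  which correspond to the kernels \<open>V\<^sub>r\<close>.  If all nodes are at least \<open>a\<close>, the
  interpolant continues affinely below \<open>a\<close> and stays below \<open>G\<close> by an amount that does not shrink
  with the mesh, because \<open>G\<close> is strictly convex near \<open>0\<close>.  With \<open>a\<close> small compared to
  the distances of the points, this surplus affects only the diagonal of the quadratic form, which
  gives strict positivity.
\<close>

section \<open>Chebyshev polynomials as positive definite kernels\<close>

fun cheb_U :: "nat \<Rightarrow> 'a::comm_ring_1 \<Rightarrow> 'a" where
  "cheb_U 0 t = 1"
| "cheb_U (Suc 0) t = 2 * t"
| "cheb_U (Suc (Suc n)) t = 2 * t * cheb_U (Suc n) t - cheb_U n t"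

lemma cheb_U_of_real: "cheb_U n (of_real t :: 'a::{real_algebra_1,comm_ring_1}) = of_real (cheb_U n t)"
  by (induction n t rule: cheb_U.induct) simp_all

text \<open>The trace of the \<open>n\<close>-th symmetric power of the matrix with rows \<open>(a, b)\<close>, \<open>(c, d)\<close>.\<close>

definition sym_trace :: "'a::comm_ring_1 \<Rightarrow> 'a \<Rightarrow> 'a \<Rightarrow> 'a \<Rightarrow> nat \<Rightarrow> 'a" where
  "sym_trace a b c d n = (\<Sum>j\<le>n. coeff ([:c, a:] ^ j * [:d, b:] ^ (n - j)) j)"

lemma coeff_linear_mult:
  "coeff ([:c, a:] * p) 0 = c * coeff p 0"
  "coeff ([:c, a:] * p) (Suc k) = a * coeff p k + c * coeff p (Suc k)"
  by (simp_all add: algebra_simps)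

lemma coeff_linear_power_eq_0: "k > j \<Longrightarrow> coeff ([:c, a:] ^ j) k = (0 :: 'a::comm_ring_1)"
proof (induction j arbitrary: k)
  case (Suc j)
  then obtain k' where "k = Suc k'" by (cases k) auto
  with Suc show ?case by (simp only: power_Suc coeff_linear_mult) auto
qed (auto simp: coeff_1)

text \<open>Besides the diagonal coefficients \<open>R\<close>, whose sum is the trace, one tracks
  the coefficients \<open>L\<close> one degree above. Peeling off a linear factor gives a
  first-order system for \<open>?T\<close> and \<open>\<Lambda>\<close>. Eliminating
  \<open>\<Lambda>\<close> leaves a recursion whose coefficients are the trace and the determinant
  of the matrix.\<close>

lemma sym_trace_rec:
  "sym_trace a b c d (Suc (Suc n)) =
     (a + d) * sym_trace a b c d (Suc n) - (a * d - b * c) * sym_trace a b c d n"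
proof -
  define R where "R = (\<lambda>j k. coeff ([:c, a:] ^ j * [:d, b:] ^ k) j)"
  define L where "L = (\<lambda>j k. coeff ([:c, a:] ^ j * [:d, b:] ^ k) (Suc j))"
  define \<Lambda> where "\<Lambda> = (\<lambda>n. \<Sum>j\<le>n. L j (n - j))"
  let ?T = "sym_trace a b c d"
  have T: "?T n = (\<Sum>j\<le>n. R j (n - j))" for n
    by (simp add: sym_trace_def R_def)
  have R0: "R 0 k = d ^ k" for k
    by (induction k) (simp_all add: R_def)
  have RS: "R (Suc j) k = a * R j k + c * L j k" for j k
    by (simp only: R_def L_def power_Suc mult.assoc coeff_linear_mult)
  have LS: "L j (Suc k) = b * R j k + d * L j k" for j k
    by (simp only: R_def L_def power_Suc mult.left_commute[of "[:c, a:] ^ j"] coeff_linear_mult)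
  have L0: "L j 0 = 0" for j
    by (simp add: L_def coeff_linear_power_eq_0)
  have TS: "?T (Suc n) = a * ?T n + c * \<Lambda> n + d ^ Suc n" for n
    unfolding T \<Lambda>_def sum.atMost_Suc_shift
    by (simp add: R0 RS sum.distrib sum_distrib_left)
  have \<Lambda>S: "\<Lambda> (Suc n) = b * ?T n + d * \<Lambda> n" for n
  proof -
    \<comment> \<open>By \<open>L0\<close> the term \<open>j = Suc n\<close> vanishes; in the other
      terms the second exponent is positive, so \<open>LS\<close> applies.\<close>
    have "\<Lambda> (Suc n) = (\<Sum>j\<le>n. L j (Suc (n - j)))"
      by (simp add: \<Lambda>_def L0 Suc_diff_le)
    then show ?thesis
      by (simp add: LS T \<Lambda>_def sum.distrib sum_distrib_left)
  qed
  show ?thesis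
    unfolding TS[of "Suc n"] \<Lambda>S[of n]
    using TS[of n] by (simp add: algebra_simps)
qed

text \<open>For trace \<open>2 * t\<close> and determinant 1 the recursion of the traces is the one
  that defines \<open>cheb_U\<close>.\<close>

lemma sym_trace_cheb_U:
  assumes "a + d = 2 * t" "a * d - b * c = 1"
  shows "sym_trace a b c d n = cheb_U n t"
  using assms
proof (induction n t rule: cheb_U.induct)
  case (1 t)
  then show ?case by (simp add: sym_trace_def)
next
  case (2 t)
  then show ?case by (simp add: sym_trace_def add.commute)
next
  case (3 n t)
  then show ?case by (simp add: sym_trace_rec)
qed

section \<open>Matrix entries of the symmetric powers of SU(2)\<close>

text \<open>Multiplicativity of symmetric powers in terms of generating polynomials. The hypothesis
  is an identity in two variables; its \<open>n\<close>-th power is expanded binomially on both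
  sides, and the coefficients of degree \<open>m\<close> in \<open>\<zeta>\<close> and of degree
  \<open>l\<close> in the other variable are compared.\<close>

lemma coeff_rank2_power:
  fixes p1 p2 q1 q2 r s :: "'a::{comm_ring_1,ring_no_zero_divisors,ring_char_0} poly"
  assumes "\<And>\<zeta>. smult (poly p1 \<zeta>) q1 + smult (poly p2 \<zeta>) q2 = smult \<zeta> r + s"
  shows "of_nat (n choose m) * coeff (r ^ m * s ^ (n - m)) l =
    (\<Sum>k\<le>n. of_nat (n choose k) * (coeff (p1 ^ k * p2 ^ (n - k)) m * coeff (q1 ^ k * q2 ^ (n - k)) l))"
    (is "?lhs = ?rhs")
proof -
  define A where "A = (\<Sum>m\<le>n. monom (of_nat (n choose m) * coeff (r ^ m * s ^ (n - m)) l) m)"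
  define B where "B = (\<Sum>k\<le>n. smult (of_nat (n choose k) * coeff (q1 ^ k * q2 ^ (n - k)) l) (p1 ^ k * p2 ^ (n - k)))"
  have "poly A \<zeta> = poly B \<zeta>" for \<zeta>
  proof -
    have "poly A \<zeta> = coeff ((smult \<zeta> r + s) ^ n) l"
      unfolding A_def binomial_ring coeff_sum poly_sum
      by (intro sum.cong refl) (simp add: poly_monom smult_power of_nat_mult_conv_smult mult_ac mult_smult_left)
    also have "\<dots> = poly B \<zeta>"
      unfolding B_def binomial_ring coeff_sum poly_sum assms[symmetric]
      by (intro sum.cong refl) (simp add: smult_power of_nat_mult_conv_smult mult_ac mult_smult_left)
    finally show ?thesis .
  qed
  then have "A = B"
    by (simp add: poly_eq_poly_eq_iff[symmetric] fun_eq_iff)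
  then have AB: "coeff A m = coeff B m" by simp
  have B: "coeff B m = ?rhs"
    by (simp add: B_def coeff_sum mult_ac)
  have A: "coeff A m = (if m \<le> n then ?lhs else 0)"
    by (auto simp: A_def coeff_sum if_distrib cong: if_cong)
  show ?thesis
    using A B AB by (cases "m \<le> n") (auto simp: binomial_eq_0)
qed

lemma coeff_linear_powers_cnj:
  "coeff ([:cnj a, cnj b:] ^ k * [:cnj c, cnj d:] ^ l) m = cnj (coeff ([:a, b:] ^ k * [:c, d:] ^ l) m)"
proof (induction k arbitrary: m)
  case 0
  show ?case
  proof (induction l arbitrary: m)
    case (Suc l)
    then show ?case
      by (cases m) (simp_all only: power_0 mult_1 power_Suc coeff_linear_mult complex_cnj_mult complex_cnj_add)
  qed (simp add: coeff_1)
next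
  case (Suc k)
  then show ?case
    by (cases m) (simp_all only: power_Suc mult.assoc coeff_linear_mult complex_cnj_mult complex_cnj_add)
qed

text \<open>Identifying \<open>x\<close> with \<open>(z1, z2)\<close>, these are entries of the symmetric power of the element of
  SU(2) with columns \<open>(z1, z2)\<close> and \<open>(- cnj z2, cnj z1)\<close>.\<close>

definition S3_entry :: "nat \<Rightarrow> nat \<Rightarrow> nat \<Rightarrow> real ^ 4 \<Rightarrow> complex" where
  "S3_entry n m k x =
     (let z1 = Complex (x $ 1) (x $ 2); z2 = Complex (x $ 3) (x $ 4)
      in coeff ([:z1, - cnj z2:] ^ k * [:z2, cnj z1:] ^ (n - k)) m)"

text \<open>With \<open>x\<close> and \<open>y\<close> read as elements of SU(2), the adjoint of the
  first times the second has determinant 1 and trace \<open>2 * (x \<bullet> y)\<close>. So the left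
  side is the trace of its symmetric power, which is a sum of products of entries. The binomial
  weights arise because the monomial basis is not orthonormal for the invariant inner
  product.\<close>

lemma cheb_U_inner_eq:
  fixes x y :: "real ^ 4"
  assumes "norm x = 1" "norm y = 1"
  shows "of_real (cheb_U n (x \<bullet> y)) =
    (\<Sum>m\<le>n. \<Sum>k\<le>n. of_real (real (n choose k) / real (n choose m)) * (cnj (S3_entry n m k x) * S3_entry n m k y))"
proof -
  define x1 x2 y1 y2 where "x1 = Complex (x $ 1) (x $ 2)" "x2 = Complex (x $ 3) (x $ 4)"
    "y1 = Complex (y $ 1) (y $ 2)" "y2 = Complex (y $ 3) (y $ 4)"
  note defs = this
  \<comment> \<open>Together with \<open>cnj w\<close> these are the entries of the adjoint of the
    matrix of \<open>x\<close> times the matrix of \<open>y\<close>.\<close>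
  define w A B where "w = cnj x1 * y1 + cnj x2 * y2" and "A = cnj x2 * cnj y1 - cnj x1 * cnj y2"
    and "B = x1 * y2 - x2 * y1"
  have nx: "x1 * cnj x1 + x2 * cnj x2 = 1"
    using assms(1) by (simp add: defs norm_eq_1 inner_vec_def sum_4 complex_eq_iff power2_eq_square)
  have ny: "y1 * cnj y1 + y2 * cnj y2 = 1"
    using assms(2) by (simp add: defs norm_eq_1 inner_vec_def sum_4 complex_eq_iff power2_eq_square)
  have "cnj w * w - A * B = (x1 * cnj x1 + x2 * cnj x2) * (y1 * cnj y1 + y2 * cnj y2)"
    by (simp add: w_def A_def B_def algebra_simps)
  then have det: "cnj w * w - A * B = 1"
    by (simp add: nx ny)
  have tr: "cnj w + w = 2 * of_real (x \<bullet> y)"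
    by (simp add: w_def defs complex_eq_iff inner_vec_def sum_4)
  have eq: "coeff ([:B, cnj w:] ^ m * [:w, A:] ^ (n - m)) m =
     (\<Sum>k\<le>n. of_real (real (n choose k) / real (n choose m)) * (cnj (S3_entry n m k x) * S3_entry n m k y))"
    if "m \<le> n" for m
  proof -
    \<comment> \<open>The nested conjugations are kept so that
      \<open>coeff_linear_powers_cnj\<close> turns the first factor into
      \<open>cnj (S3_entry n m k x)\<close>.\<close>
    have *: "of_nat (n choose m) * coeff ([:B, cnj w:] ^ m * [:w, A:] ^ (n - m)) m =
       (\<Sum>k\<le>n. of_nat (n choose k) * (coeff ([:cnj x1, cnj (- cnj x2):] ^ k * [:cnj x2, cnj (cnj x1):] ^ (n - k)) m
           * coeff ([:y1, - cnj y2:] ^ k * [:y2, cnj y1:] ^ (n - k)) m))"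
      by (rule coeff_rank2_power) (simp add: w_def A_def B_def algebra_simps)
    have "of_nat (n choose m) \<noteq> (0::complex)"
      using that by simp
    then show ?thesis
      using * unfolding coeff_linear_powers_cnj
      by (simp add: S3_entry_def Let_def defs[symmetric] sum_divide_distrib[symmetric] field_simps)
  qed
  have "of_real (cheb_U n (x \<bullet> y)) = cheb_U n (of_real (x \<bullet> y) :: complex)"
    by (simp add: cheb_U_of_real)
  also have "\<dots> = sym_trace (cnj w) A B w n"
    by (rule sym_trace_cheb_U[symmetric]) (use tr det in auto)
  also have "\<dots> = (\<Sum>m\<le>n. coeff ([:B, cnj w:] ^ m * [:w, A:] ^ (n - m)) m)"
    by (simp add: sym_trace_def)
  finally show ?thesis
    by (simp add: eq)
qed

lemma sum_swap3:
  fixes f :: "'a \<Rightarrow> 'b \<Rightarrow> 'c \<Rightarrow> 'd::comm_monoid_add"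
  shows "(\<Sum>i\<in>A. \<Sum>j\<in>B. \<Sum>m\<in>C. f i j m) = (\<Sum>m\<in>C. \<Sum>i\<in>A. \<Sum>j\<in>B. f i j m)"
proof -
  have *: "(\<Sum>j\<in>B. \<Sum>m\<in>C. f i j m) = (\<Sum>m\<in>C. \<Sum>j\<in>B. f i j m)" for i
    by (rule sum.swap)
  show ?thesis
    unfolding * by (rule sum.swap)
qed

text \<open>Inserting \<open>cheb_U_inner_eq\<close> turns the quadratic form into a sum of squared
  moduli with nonnegative weights.\<close>

lemma cheb_U_inner_nonneg:
  fixes x :: "'i \<Rightarrow> real ^ 4" and c :: "'i \<Rightarrow> real"
  assumes "\<And>i. i \<in> I \<Longrightarrow> norm (x i) = 1"
  shows "(\<Sum>i\<in>I. \<Sum>j\<in>I. c i * c j * cheb_U n (x i \<bullet> x j)) \<ge> 0"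
proof -
  let ?w = "\<lambda>m k. real (n choose k) / real (n choose m)"
  let ?v = "\<lambda>m k. \<Sum>i\<in>I. of_real (c i) * S3_entry n m k (x i)"
  have "complex_of_real (\<Sum>i\<in>I. \<Sum>j\<in>I. c i * c j * cheb_U n (x i \<bullet> x j)) =
      (\<Sum>i\<in>I. \<Sum>j\<in>I. \<Sum>m\<le>n. \<Sum>k\<le>n. of_real (?w m k) *
        (cnj (of_real (c i) * S3_entry n m k (x i)) * (of_real (c j) * S3_entry n m k (x j))))"
    unfolding of_real_sum of_real_mult
    by (intro sum.cong refl) (simp add: assms cheb_U_inner_eq sum_distrib_left mult_ac)
  also have "\<dots> = (\<Sum>m\<le>n. \<Sum>k\<le>n. \<Sum>i\<in>I. \<Sum>j\<in>I. of_real (?w m k) *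
        (cnj (of_real (c i) * S3_entry n m k (x i)) * (of_real (c j) * S3_entry n m k (x j))))"
    by (subst sum_swap3, subst sum_swap3, rule refl)
  also have "\<dots> = (\<Sum>m\<le>n. \<Sum>k\<le>n. of_real (?w m k) * (cnj (?v m k) * ?v m k))"
    by (simp only: cnj_sum sum_product) (simp only: sum_distrib_left)
  also have "\<dots> = of_real (\<Sum>m\<le>n. \<Sum>k\<le>n. ?w m k * (cmod (?v m k))\<^sup>2)"
    by (simp only: of_real_sum of_real_mult complex_norm_square mult.commute[of "cnj _"])
  finally have "(\<Sum>i\<in>I. \<Sum>j\<in>I. c i * c j * cheb_U n (x i \<bullet> x j)) =
      (\<Sum>m\<le>n. \<Sum>k\<le>n. ?w m k * (cmod (?v m k))\<^sup>2)"
    by (simp only: of_real_eq_iff)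
  then show ?thesis
    by (simp add: sum_nonneg)
qed

section \<open>Trigonometric form and size of \<open>cheb_U\<close> at cosines\<close>

lemma sin_cheb_U: "sin ((real n + 1) * \<theta>) = cheb_U n (cos \<theta>) * sin \<theta>"
proof -
  have "sin ((real n + 1) * \<theta>) = cheb_U n (cos \<theta>) * sin \<theta> \<and>
        sin ((real n + 2) * \<theta>) = cheb_U (Suc n) (cos \<theta>) * sin \<theta>"
  proof (induction n)
    case 0
    then show ?case by (simp add: sin_double)
  next
    case (Suc n)
    have "sin ((real n + 3) * \<theta>) + sin ((real n + 1) * \<theta>) = 2 * cos \<theta> * sin ((real n + 2) * \<theta>)"
      using sin_add[of "(real n + 2) * \<theta>" \<theta>] sin_diff[of "(real n + 2) * \<theta>" \<theta>]
      by (simp add: algebra_simps)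
    with Suc show ?case by (simp add: algebra_simps)
  qed
  then show ?thesis ..
qed

text \<open>A recursion of order one, from which the bound \<open>n + 1\<close> follows by induction
  without dividing by \<open>sin \<theta>\<close>.\<close>

lemma cheb_U_Suc_cos:
  "cheb_U (Suc n) (cos \<theta>) = cos \<theta> * cheb_U n (cos \<theta>) + cos ((real n + 1) * \<theta>)"
proof -
  have "cheb_U (Suc n) (cos \<theta>) = cos \<theta> * cheb_U n (cos \<theta>) + cos ((real n + 1) * \<theta>) \<and>
        cheb_U (Suc (Suc n)) (cos \<theta>) = cos \<theta> * cheb_U (Suc n) (cos \<theta>) + cos ((real n + 2) * \<theta>)"
  proof (induction n)
    case 0
    then show ?case by (simp add: cos_double_cos power2_eq_square)
  next
    case (Suc n)
    have *: "cos ((real n + 3) * \<theta>) + cos ((real n + 1) * \<theta>) = 2 * cos \<theta> * cos ((real n + 2) * \<theta>)"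
      using cos_add[of "(real n + 2) * \<theta>" \<theta>] cos_diff[of "(real n + 2) * \<theta>" \<theta>]
      by (simp add: algebra_simps)
    have IH: "cheb_U (Suc n) (cos \<theta>) - cos \<theta> * cheb_U n (cos \<theta>) = cos ((real n + 1) * \<theta>)"
      "cheb_U (Suc (Suc n)) (cos \<theta>) - cos \<theta> * cheb_U (Suc n) (cos \<theta>) = cos ((real n + 2) * \<theta>)"
      using Suc by linarith+
    have "cheb_U (Suc (Suc (Suc n))) (cos \<theta>) - cos \<theta> * cheb_U (Suc (Suc n)) (cos \<theta>) =
        2 * cos \<theta> * (cheb_U (Suc (Suc n)) (cos \<theta>) - cos \<theta> * cheb_U (Suc n) (cos \<theta>)) -
        (cheb_U (Suc n) (cos \<theta>) - cos \<theta> * cheb_U n (cos \<theta>))"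
      by (simp add: algebra_simps)
    also have "\<dots> = 2 * cos \<theta> * cos ((real n + 2) * \<theta>) - cos ((real n + 1) * \<theta>)"
      unfolding IH ..
    finally have **: "cheb_U (Suc (Suc (Suc n))) (cos \<theta>) =
        cos \<theta> * cheb_U (Suc (Suc n)) (cos \<theta>) + cos ((real n + 3) * \<theta>)"
      using * by linarith
    have "real (Suc n) + 1 = real n + 2" "real (Suc n) + 2 = real n + 3"
      by simp_all
    then show ?case using ** Suc by metis
  qed
  then show ?thesis ..
qed

lemma abs_cheb_U_cos_le: "\<bar>cheb_U n (cos \<theta>)\<bar> \<le> real n + 1"
proof (induction n)
  case (Suc n)
  have "\<bar>cheb_U (Suc n) (cos \<theta>)\<bar> \<le> \<bar>cos \<theta>\<bar> * \<bar>cheb_U n (cos \<theta>)\<bar> + \<bar>cos ((real n + 1) * \<theta>)\<bar>"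
    unfolding cheb_U_Suc_cos abs_mult[symmetric] by (rule abs_triangle_ineq)
  also have "\<dots> \<le> 1 * (real n + 1) + 1"
    using Suc by (intro add_mono mult_mono) auto
  finally show ?case by simp
qed simp

section \<open>Overlap of spherical caps\<close>

text \<open>The volume of the overlap divided by \<open>pi\<close>, in closed form; the second
  branch belongs to disjoint caps. For \<open>r = pi / 2\<close> the tangent has coefficient 0 and
  the first branch is \<open>pi - \<theta>\<close>.\<close>

definition cap_overlap :: "real \<Rightarrow> real \<Rightarrow> real" where
  "cap_overlap r \<theta> =
     (if \<theta> \<le> 2 * r then 2 * r - \<theta> - sin (2 * r) + 2 * (cos r)\<^sup>2 * tan (\<theta> / 2) else 0)"

text \<open>Twice the integral of \<open>sin ((n + 1) t) sin t\<close> over \<open>[0, r]\<close>; the case \<open>n = 0\<close> is the limit of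
  \<open>sin (n r) / n\<close>.\<close>

definition cap_coeff :: "nat \<Rightarrow> real \<Rightarrow> real" where
  "cap_coeff n r =
     (if n = 0 then r else sin (real n * r) / real n) - sin ((real n + 2) * r) / (real n + 2)"

section \<open>Sine coefficients of the overlap volume\<close>

lemma tan_half_sin: "tan (\<theta> / 2) * sin \<theta> = 1 - cos \<theta>" if "cos (\<theta> / 2) \<noteq> 0" for \<theta> :: real
proof -
  have s: "sin \<theta> = 2 * sin (\<theta> / 2) * cos (\<theta> / 2)" and c: "cos \<theta> = 1 - 2 * (sin (\<theta> / 2))\<^sup>2"
    using sin_double[of "\<theta> / 2"] cos_double_sin[of "\<theta> / 2"] by simp_all
  show ?thesis
    using that by (simp add: s c tan_def power2_eq_square)
qed

text \<open>The weight \<open>sin \<theta>\<close> of the sine coefficients cancels the tangent, so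
  their integrand has an elementary antiderivative. At \<open>\<theta> = pi\<close> both sides
  vanish.\<close>

lemma cap_overlap_sin:
  assumes "0 < r" "r \<le> pi / 2" "0 \<le> \<theta>" "\<theta> \<le> 2 * r"
  shows "cap_overlap r \<theta> * sin \<theta> = (2 * r - sin (2 * r) - \<theta>) * sin \<theta> + 2 * (cos r)\<^sup>2 * (1 - cos \<theta>)"
proof (cases "\<theta> = pi")
  case True
  then have "r = pi / 2" using assms by simp
  then show ?thesis unfolding True \<open>r = pi / 2\<close> by (simp add: cap_overlap_def)
next
  case False
  then have "\<theta> / 2 < pi / 2" using assms by simp
  then have "cos (\<theta> / 2) > 0" using assms by (intro cos_gt_zero_pi) auto
  then have t: "tan (\<theta> / 2) * sin \<theta> = 1 - cos \<theta>"
    by (intro tan_half_sin) simp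
  have "cap_overlap r \<theta> * sin \<theta> =
      (2 * r - sin (2 * r) - \<theta>) * sin \<theta> + 2 * (cos r)\<^sup>2 * (tan (\<theta> / 2) * sin \<theta>)"
    using assms by (simp add: cap_overlap_def algebra_simps)
  then show ?thesis
    unfolding t .
qed

text \<open>For \<open>p = n * r\<close> and \<open>q = (n + 2) * r\<close> the left side is what
  the antiderivative below yields for the \<open>n\<close>-th sine coefficient of the overlap. That
  it is a square over \<open>n + 1\<close> is the source of positive definiteness.\<close>

lemma cap_coeff_identity:
  fixes n p q :: real
  assumes n: "n > 0"
  shows "- sin (q - p) / 2 * (sin (2 * p) / n - sin (2 * q) / (n + 2))
     + (1 - cos (2 * p)) / (2 * n\<^sup>2) - (1 - cos (2 * q)) / (2 * (n + 2)\<^sup>2)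
     + (1 + cos (q - p)) * ((1 - cos (p + q)) / (n + 1) - (1 - cos (2 * q)) / (2 * (n + 2)) - (1 - cos (2 * p)) / (2 * n))
   = (sin p / n - sin q / (n + 2))\<^sup>2 / (n + 1)" (is "?lhs = ?rhs")
proof -
  define a b c d where "a = sin p" and "b = sin q" and "c = cos p" and "d = cos q"
  note defs = this
  define x y z where "x = 1 / n" "y = 1 / (n + 2)" "z = 1 / (n + 1)"
  note xyz = this
  have cc: "c * c = 1 - a * a" and dd: "d * d = 1 - b * b"
    unfolding defs using sin_cos_squared_add3[of p] sin_cos_squared_add3[of q] by linarith+
  have *: "1 - cos (2 * p) = 2 * a\<^sup>2" "1 - cos (2 * q) = 2 * b\<^sup>2"
    by (simp_all add: cos_double_sin defs)
  have e: "(1 - cos (2 * p)) / (2 * n\<^sup>2) = a\<^sup>2 * x\<^sup>2" "(1 - cos (2 * p)) / (2 * n) = a\<^sup>2 * x"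
    "(1 - cos (2 * q)) / (2 * (n + 2)\<^sup>2) = b\<^sup>2 * y\<^sup>2" "(1 - cos (2 * q)) / (2 * (n + 2)) = b\<^sup>2 * y"
    "sin (2 * p) / n = 2 * (a * c * x)" "sin (2 * q) / (n + 2) = 2 * (b * d * y)"
    "(1 - cos (p + q)) / (n + 1) = (1 - (c * d - a * b)) * z"
    unfolding * xyz by (simp_all add: power_divide cos_add sin_double defs del: distrib_left_numeral)
  have "?lhs = - (b * c - d * a) * (a * c * x - b * d * y) + a\<^sup>2 * x\<^sup>2 - b\<^sup>2 * y\<^sup>2
     + (1 + (c * d + a * b)) * ((1 - (c * d - a * b)) * z - b\<^sup>2 * y - a\<^sup>2 * x)"
    unfolding e by (simp add: sin_diff cos_diff defs field_simps)
  also have "\<dots> = z * (a + b)\<^sup>2 - a * b * (x + y) - b\<^sup>2 * y - a\<^sup>2 * x + a\<^sup>2 * x\<^sup>2 - b\<^sup>2 * y\<^sup>2"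
    using cc dd by algebra
  also have "\<dots> = a\<^sup>2 * (z - x + x\<^sup>2) + b\<^sup>2 * (z - y - y\<^sup>2) + a * b * (2 * z - x - y)"
    by (simp add: power2_eq_square algebra_simps)
  \<comment> \<open>Partial fractions in the reciprocals of \<open>n\<close>, \<open>n + 1\<close>
    and \<open>n + 2\<close> extract the common factor \<open>z\<close>, and what remains of the
    quadratic form in \<open>a\<close> and \<open>b\<close> is a perfect square.\<close>
  also have "z - x + x\<^sup>2 = z * x\<^sup>2"
    unfolding xyz using n by (simp add: divide_simps power2_eq_square)
  also have "z - y - y\<^sup>2 = z * y\<^sup>2"
    unfolding xyz using n by (simp add: divide_simps power2_eq_square)
  also have "2 * z - x - y = - 2 * z * x * y"
    unfolding xyz using n by (simp add: divide_simps, simp add: algebra_simps)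
  also have "a\<^sup>2 * (z * x\<^sup>2) + b\<^sup>2 * (z * y\<^sup>2) + a * b * (- 2 * z * x * y) = (a * x - b * y)\<^sup>2 * z"
    by (simp add: power2_eq_square algebra_simps)
  also have "\<dots> = ?rhs"
    by (simp add: xyz defs)
  finally show ?thesis .
qed

text \<open>The integral is evaluated by an explicit antiderivative. The case \<open>n = 0\<close>
  is separate because the general formula divides by \<open>n\<close>.\<close>

lemma cap_overlap_has_integral_aux:
  assumes "0 < r"
  shows "((\<lambda>\<theta>. ((2 * r - sin (2 * r) - \<theta>) * sin \<theta> + 2 * (cos r)\<^sup>2 * (1 - cos \<theta>)) * sin ((real n + 1) * \<theta>))
    has_integral (cap_coeff n r)\<^sup>2 / (real n + 1)) {0..2 * r}"
proof (cases "n = 0")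
  case True
  define \<Phi> where "\<Phi> = (\<lambda>\<theta>. (2 * r - sin (2 * r) - \<theta>) / 2 * (\<theta> - sin (2 * \<theta>) / 2)
    + (\<theta>\<^sup>2 / 2 + cos (2 * \<theta>) / 4) / 2 + 2 * (cos r)\<^sup>2 * (cos (2 * \<theta>) / 4 - cos \<theta>))"
  have "((\<lambda>\<theta>. ((2 * r - sin (2 * r) - \<theta>) * sin \<theta> + 2 * (cos r)\<^sup>2 * (1 - cos \<theta>)) * sin \<theta>)
    has_integral (\<Phi> (2 * r) - \<Phi> 0)) {0..2 * r}"
  proof (rule fundamental_theorem_of_calculus)
    fix x
    have eq: "((2 * r - sin (2 * r) - x) * sin x + 2 * (cos r)\<^sup>2 * (1 - cos x)) * sin x =
      (2 * r - sin (2 * r) - x) / 2 * (1 - cos (2 * x)) + 2 * (cos r)\<^sup>2 * (sin x - sin (2 * x) / 2)"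
      unfolding cos_double_sin[of x] sin_double[of x] by (simp add: field_simps power2_eq_square)
    have "(\<Phi> has_real_derivative
       ((2 * r - sin (2 * r) - x) * sin x + 2 * (cos r)\<^sup>2 * (1 - cos x)) * sin x) (at x)"
      unfolding eq \<Phi>_def
      by (rule derivative_eq_intros refl | simp)+
    then show "(\<Phi> has_vector_derivative
       ((2 * r - sin (2 * r) - x) * sin x + 2 * (cos r)\<^sup>2 * (1 - cos x)) * sin x) (at x within {0..2 * r})"
      by (simp add: has_real_derivative_iff_has_vector_derivative has_vector_derivative_at_within)
  qed (use assms in simp)
  moreover have "\<Phi> (2 * r) - \<Phi> 0 = (cap_coeff 0 r)\<^sup>2"
  proof -
    define s c where "s = sin (2 * r)" "c = cos (2 * r)"
    note sc = this
    have cc: "c * c = 1 - s * s"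
      unfolding sc using sin_cos_squared_add3[of "2 * r"] by linarith
    have s4: "sin (4 * r) = 2 * s * c" and c4: "cos (4 * r) = 1 - 2 * s\<^sup>2" and cr: "(cos r)\<^sup>2 = (1 + c) / 2"
      using sin_double[of "2 * r"] cos_double_sin[of "2 * r"] cos_double_cos[of r] by (simp_all add: sc)
    have "\<Phi> (2 * r) - \<Phi> 0 = - s / 2 * (2 * r - s * c) + (2 * r\<^sup>2 + (1 - 2 * s\<^sup>2) / 4 - 1 / 4) / 2
        + (1 + c) * ((1 - 2 * s\<^sup>2) / 4 - c + 3 / 4)"
      unfolding \<Phi>_def by (simp add: s4 c4 cr sc[symmetric]) (simp add: field_simps)
    also have "\<dots> = (r - s / 2)\<^sup>2"
      using cc by (simp add: divide_simps) algebra
    finally show ?thesis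
      by (simp add: cap_coeff_def sc)
  qed
  ultimately show ?thesis
    using True by simp
next
  case False
  then have n: "real n > 0" by simp
  \<comment> \<open>After product-to-sum formulas, the first summand integrates the part with the
    linear factor by parts, the second compensates the derivative of that factor, and the third
    integrates the part with \<open>(cos r)\<^sup>2\<close>.\<close>
  define \<Phi> where "\<Phi> = (\<lambda>\<theta>.
    (2 * r - sin (2 * r) - \<theta>) / 2 * (sin (real n * \<theta>) / real n - sin ((real n + 2) * \<theta>) / (real n + 2))
    + (cos ((real n + 2) * \<theta>) / (real n + 2)\<^sup>2 - cos (real n * \<theta>) / (real n)\<^sup>2) / 2
    + 2 * (cos r)\<^sup>2 * ((cos ((real n + 2) * \<theta>) / (real n + 2) + cos (real n * \<theta>) / real n) / 2
        - cos ((real n + 1) * \<theta>) / (real n + 1)))"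
  have "((\<lambda>\<theta>. ((2 * r - sin (2 * r) - \<theta>) * sin \<theta> + 2 * (cos r)\<^sup>2 * (1 - cos \<theta>)) * sin ((real n + 1) * \<theta>))
    has_integral (\<Phi> (2 * r) - \<Phi> 0)) {0..2 * r}"
  proof (rule fundamental_theorem_of_calculus)
    fix x
    have e: "real n * x = (real n + 1) * x - x" "(real n + 2) * x = (real n + 1) * x + x"
      by (simp_all add: algebra_simps)
    have eq: "((2 * r - sin (2 * r) - x) * sin x + 2 * (cos r)\<^sup>2 * (1 - cos x)) * sin ((real n + 1) * x) =
      (2 * r - sin (2 * r) - x) / 2 * (cos (n * x) - cos ((real n + 2) * x)) +
      2 * (cos r)\<^sup>2 * (sin ((real n + 1) * x) - (sin ((real n + 2) * x) + sin (n * x)) / 2)"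
      unfolding e cos_add cos_diff sin_add sin_diff by (simp add: field_simps)
    have n1: "real n + 1 > 0" and n2: "real n + 2 > 0" by simp_all
    have d1: "((\<lambda>\<theta>. sin (k * \<theta>) / k) has_real_derivative cos (k * x)) (at x)" if "k > 0" for k
      by (rule derivative_eq_intros refl | use that in simp)+
    have d2: "((\<lambda>\<theta>. cos (k * \<theta>) / k) has_real_derivative - sin (k * x)) (at x)" if "k > 0" for k
      by (rule derivative_eq_intros refl | use that in simp)+
    have d3: "((\<lambda>\<theta>. cos (k * \<theta>) / k\<^sup>2) has_real_derivative - (sin (k * x) / k)) (at x)" if "k > 0" for k
      by (rule derivative_eq_intros refl | use that in \<open>simp add: power2_eq_square\<close>)+
    note P = DERIV_diff[OF d1[OF n] d1[OF n2]]
    note Q = DERIV_diff[OF d3[OF n2] d3[OF n]]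
    note R = DERIV_diff[OF DERIV_cdivide[OF DERIV_add[OF d2[OF n2] d2[OF n]], of 2] d2[OF n1]]
    have "((\<lambda>\<theta>. (2 * r - sin (2 * r) - \<theta>) / 2) has_real_derivative - 1 / 2) (at x)"
      by (rule derivative_eq_intros refl | simp)+
    note DERIV_add[OF DERIV_add[OF DERIV_mult[OF this P] DERIV_cdivide[OF Q, of 2]]
      DERIV_cmult[OF R, of "2 * (cos r)\<^sup>2"]]
    then have "(\<Phi> has_real_derivative
       ((2 * r - sin (2 * r) - x) * sin x + 2 * (cos r)\<^sup>2 * (1 - cos x)) * sin ((real n + 1) * x)) (at x)"
      unfolding eq \<Phi>_def
      by (rule DERIV_cong) (simp add: algebra_simps diff_divide_distrib add_divide_distrib)
    then show "(\<Phi> has_vector_derivative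
       ((2 * r - sin (2 * r) - x) * sin x + 2 * (cos r)\<^sup>2 * (1 - cos x)) * sin ((real n + 1) * x)) (at x within {0..2 * r})"
      by (simp add: has_real_derivative_iff_has_vector_derivative has_vector_derivative_at_within)
  qed (use assms in simp)
  moreover have "\<Phi> (2 * r) - \<Phi> 0 = (cap_coeff n r)\<^sup>2 / (real n + 1)"
  proof -
    define p q where "p = real n * r" "q = (real n + 2) * r"
    note pq = this
    have e: "2 * r = q - p" "real n * (2 * r) = 2 * p" "(real n + 2) * (2 * r) = 2 * q" "(real n + 1) * (2 * r) = p + q"
      by (simp_all add: pq algebra_simps)
    have c: "2 * (cos r)\<^sup>2 = 1 + cos (q - p)"
      using cos_double_cos[of r] by (simp add: e(1)[symmetric])
    have K: "cap_coeff n r = sin p / n - sin q / (real n + 2)"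
      using n by (simp add: cap_coeff_def pq)
    have "\<Phi> (2 * r) - \<Phi> 0 = - sin (q - p) / 2 * (sin (2 * p) / real n - sin (2 * q) / (real n + 2))
       + (1 - cos (2 * p)) / (2 * (real n)\<^sup>2) - (1 - cos (2 * q)) / (2 * (real n + 2)\<^sup>2)
       + (1 + cos (q - p)) * ((1 - cos (p + q)) / (real n + 1) - (1 - cos (2 * q)) / (2 * (real n + 2))
           - (1 - cos (2 * p)) / (2 * real n))"
      unfolding \<Phi>_def c
      unfolding e(2-)
      unfolding e(1)
      by (simp only: divide_inverse inverse_mult_distrib) (simp add: algebra_simps add_divide_distrib diff_divide_distrib)
    also have "\<dots> = (sin p / real n - sin q / (real n + 2))\<^sup>2 / (real n + 1)"
      by (rule cap_coeff_identity[OF n])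
    finally show ?thesis
      unfolding K .
  qed
  ultimately show ?thesis by simp
qed

text \<open>The branches match at \<open>2 * r\<close> because
  \<open>2 * (cos r)\<^sup>2 * tan r = sin (2 * r)\<close>. The case \<open>r = pi / 2\<close> is
  separate because the tangent has its pole at \<open>\<theta> = pi\<close>.\<close>

lemma continuous_on_cap_overlap:
  assumes "0 < r" "r \<le> pi / 2"
  shows "continuous_on {0..pi} (cap_overlap r)"
proof (cases "r = pi / 2")
  case True
  have "continuous_on {0..pi} (\<lambda>\<theta>::real. pi - \<theta>)"
    by (intro continuous_intros)
  then show ?thesis
    by (rule continuous_on_eq) (simp add: cap_overlap_def True)
next
  case False
  then have r: "r < pi / 2" using assms by simp
  have "cos r > 0" using r assms by (intro cos_gt_zero_pi) auto
  then have "2 * (cos r)\<^sup>2 * tan r = sin (2 * r)"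
    by (simp add: tan_def sin_double power2_eq_square)
  then have 0: "2 * r - 2 * r - sin (2 * r) + 2 * (cos r)\<^sup>2 * tan (2 * r / 2) = 0"
    by simp
  have "continuous_on {0..2 * r} (\<lambda>\<theta>. 2 * r - \<theta> - sin (2 * r) + 2 * (cos r)\<^sup>2 * tan (\<theta> / 2))"
  proof (intro continuous_intros ballI)
    fix x assume "x \<in> {0..2 * r}"
    then have "cos (x / 2) > 0" using r by (intro cos_gt_zero_pi) auto
    then show "cos (x / 2) \<noteq> 0" by simp
  qed simp
  then have "continuous_on ({0..2 * r} \<union> {2 * r..pi})
      (\<lambda>\<theta>. if \<theta> \<le> 2 * r then 2 * r - \<theta> - sin (2 * r) + 2 * (cos r)\<^sup>2 * tan (\<theta> / 2) else 0)"
    using 0 by (intro continuous_on_cases continuous_on_const) force+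
  also have "{0..2 * r} \<union> {2 * r..pi} = {0..pi}"
    using r assms by auto
  finally show ?thesis
    unfolding cap_overlap_def .
qed

lemma cap_overlap_has_integral:
  assumes "0 < r" "r \<le> pi / 2"
  shows "((\<lambda>\<theta>. cap_overlap r \<theta> * sin \<theta> * sin ((real n + 1) * \<theta>))
    has_integral (cap_coeff n r)\<^sup>2 / (real n + 1)) {0..pi}"
proof -
  have 1: "((\<lambda>\<theta>. cap_overlap r \<theta> * sin \<theta> * sin ((real n + 1) * \<theta>))
    has_integral (cap_coeff n r)\<^sup>2 / (real n + 1)) {0..2 * r}"
    using cap_overlap_has_integral_aux[OF assms(1), of n]
    by (rule has_integral_eq[rotated]) (use assms in \<open>simp add: cap_overlap_sin\<close>)
  \<comment> \<open>The point \<open>2 * r\<close> still belongs to the first branch of the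
    definition, so the vanishing there needs its own argument.\<close>
  have "cap_overlap r (2 * r) * sin (2 * r) = 0"
    using cap_overlap_sin[OF assms, of "2 * r"] assms
    by (simp add: cos_double_sin sin_double power2_eq_square)
  then have 2: "((\<lambda>\<theta>. cap_overlap r \<theta> * sin \<theta> * sin ((real n + 1) * \<theta>)) has_integral 0) {2 * r..pi}"
    by (intro has_integral_is_0) (force simp: cap_overlap_def)
  show ?thesis
    using has_integral_combine[OF _ _ 1 2] assms by simp
qed

lemma abs_cap_coeff_le: "n > 0 \<Longrightarrow> \<bar>cap_coeff n r\<bar> \<le> 2 / real n"
proof -
  assume n: "n > 0"
  have "\<bar>cap_coeff n r\<bar> \<le> \<bar>sin (real n * r) / real n\<bar> + \<bar>sin ((real n + 2) * r) / (real n + 2)\<bar>"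
    unfolding cap_coeff_def using n by (simp only: abs_triangle_ineq4 if_False neq0_conv[symmetric])
  also have "\<dots> \<le> 1 / real n + 1 / real n"
    unfolding abs_divide using n by (intro add_mono frac_le) auto
  finally show ?thesis by simp
qed

text \<open>The coefficient \<open>(cap_coeff n r)\<^sup>2 / (n + 1)\<close> times the bound
  \<open>n + 1\<close> for \<open>cheb_U\<close> is the summand here, so this is what makes the
  expansion converge uniformly.\<close>

lemma summable_cap_coeff: "summable (\<lambda>n. (cap_coeff n r)\<^sup>2)"
proof (rule summable_comparison_test_ev)
  show "summable (\<lambda>n. 4 * inverse (real n ^ 2))"
    by (intro summable_mult inverse_power_summable) simp
  have "(cap_coeff n r)\<^sup>2 \<le> 4 * inverse (real n ^ 2)" if "n > 0" for n
  proof -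
    have "\<bar>cap_coeff n r\<bar>\<^sup>2 \<le> (2 / real n)\<^sup>2"
      by (intro power_mono abs_cap_coeff_le that) simp
    then show ?thesis by (simp add: power_divide divide_simps)
  qed
  then show "eventually (\<lambda>n. norm ((cap_coeff n r)\<^sup>2) \<le> 4 * inverse (real n ^ 2)) sequentially"
    unfolding eventually_sequentially by (intro exI[of _ 1]) auto
qed

section \<open>Sine expansions\<close>

lemma continuous_on_cheb_U [continuous_intros]:
  fixes f :: "_ \<Rightarrow> 'a::{real_normed_algebra_1, comm_ring_1}"
  assumes "continuous_on S f"
  shows "continuous_on S (\<lambda>x. cheb_U n (f x))"
proof -
  have "continuous_on S (\<lambda>x. cheb_U n (f x)) \<and> continuous_on S (\<lambda>x. cheb_U (Suc n) (f x))"
    by (induction n) (auto intro!: continuous_intros assms)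
  then show ?thesis ..
qed

section \<open>Orthogonality and completeness of the sine system\<close>

lemma sin_sin_orthogonal:
  "((\<lambda>\<theta>. sin ((real n + 1) * \<theta>) * sin ((real m + 1) * \<theta>)) has_integral (if n = m then pi / 2 else 0)) {0..pi}"
proof (cases "n = m")
  case True
  define k where "k = real n + 1"
  have k: "k > 0" by (simp add: k_def)
  have "((\<lambda>\<theta>. sin (k * \<theta>) * sin (k * \<theta>)) has_integral
      ((pi - sin (2 * (k * pi)) / (2 * k)) / 2 - (0 - sin (2 * (k * 0)) / (2 * k)) / 2)) {0..pi}"
  proof (rule fundamental_theorem_of_calculus)
    fix x :: real
    have e: "sin (k * x) * sin (k * x) = (1 - cos (2 * (k * x))) / 2"
      using cos_double_sin[of "k * x"] by (simp add: power2_eq_square)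
    have "((\<lambda>\<theta>. (\<theta> - sin (2 * (k * \<theta>)) / (2 * k)) / 2) has_real_derivative
       sin (k * x) * sin (k * x)) (at x)"
      unfolding e using k by (auto intro!: derivative_eq_intros simp: field_simps)
    then show "((\<lambda>\<theta>. (\<theta> - sin (2 * (k * \<theta>)) / (2 * k)) / 2) has_vector_derivative
       sin (k * x) * sin (k * x)) (at x within {0..pi})"
      by (simp add: has_real_derivative_iff_has_vector_derivative has_vector_derivative_at_within)
  qed simp
  moreover have "sin (2 * (k * pi)) = 0"
    using sin_npi[of "2 * (n + 1)"] by (simp add: k_def algebra_simps)
  ultimately show ?thesis
    using True by (simp add: k_def)
next
  case False
  define a b where "a = real n - real m" and "b = real n + real m + 2"
  have ab: "a \<noteq> 0" "b \<noteq> 0"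
    using False by (auto simp: a_def b_def)
  have "((\<lambda>\<theta>. sin ((real n + 1) * \<theta>) * sin ((real m + 1) * \<theta>)) has_integral
      ((sin (a * pi) / a - sin (b * pi) / b) / 2 - (sin (a * 0) / a - sin (b * 0) / b) / 2)) {0..pi}"
  proof (rule fundamental_theorem_of_calculus)
    fix x :: real
    have e: "a * x = (real n + 1) * x - (real m + 1) * x" "b * x = (real n + 1) * x + (real m + 1) * x"
      by (simp_all add: a_def b_def algebra_simps)
    have e': "sin ((real n + 1) * x) * sin ((real m + 1) * x) = (cos (a * x) - cos (b * x)) / 2"
      unfolding e cos_diff cos_add by simp
    have "((\<lambda>\<theta>. (sin (a * \<theta>) / a - sin (b * \<theta>) / b) / 2) has_real_derivative
       sin ((real n + 1) * x) * sin ((real m + 1) * x)) (at x)"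
      unfolding e' using ab by (auto intro!: derivative_eq_intros simp: field_simps)
    then show "((\<lambda>\<theta>. (sin (a * \<theta>) / a - sin (b * \<theta>) / b) / 2) has_vector_derivative
       sin ((real n + 1) * x) * sin ((real m + 1) * x)) (at x within {0..pi})"
      by (simp add: has_real_derivative_iff_has_vector_derivative has_vector_derivative_at_within)
  qed simp
  moreover have "sin (a * pi) = 0" "sin (b * pi) = 0"
    using sin_zero_iff_int2[of "a * pi"] sin_npi[of "n + m + 2"]
    by (auto simp: a_def b_def algebra_simps intro!: exI[of _ "int n - int m"])
  ultimately show ?thesis
    using False by simp
qed

text \<open>Against the weight \<open>(sin \<theta>)\<^sup>2\<close>, \<open>D\<close> is orthogonal
  to all \<open>cheb_U n (cos \<theta>)\<close> and hence to all polynomials in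
  \<open>cos \<theta>\<close>. Uniform approximation of \<open>D\<close> by such polynomials shows
  that the weighted integral of its square is 0.\<close>

lemma sine_complete:
  fixes D :: "real \<Rightarrow> real"
  assumes cont: "continuous_on {0..pi} D"
    and orth: "\<And>m. ((\<lambda>\<theta>. D \<theta> * sin \<theta> * sin ((real m + 1) * \<theta>)) has_integral 0) {0..pi}"
    and \<theta>: "\<theta> \<in> {0..pi}"
  shows "D \<theta> = 0"
proof -
  define w where "w = (\<lambda>\<theta>. D \<theta> * (sin \<theta>)\<^sup>2)"
  have cw: "continuous_on {0..pi} w"
    unfolding w_def by (intro continuous_intros cont)
  \<comment> \<open>With \<open>n\<close> arbitrary, induction on \<open>i\<close> works: twice the
    cosine times \<open>cheb_U n\<close> is the sum of the two neighbours of
    \<open>cheb_U n\<close>, which trades a power of the cosine for a shift of the index.\<close>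
  have pow: "((\<lambda>\<theta>. w \<theta> * (cos \<theta> ^ i * cheb_U n (cos \<theta>))) has_integral 0) {0..pi}" for i n
  proof (induction i arbitrary: n)
    case 0
    show ?case
      using orth[of n] unfolding sin_cheb_U
      by (simp add: w_def power2_eq_square mult_ac)
  next
    case (Suc i)
    show ?case
    proof (cases n)
      case 0
      have "((\<lambda>\<theta>. w \<theta> * (cos \<theta> ^ i * cheb_U 1 (cos \<theta>)) / 2) has_integral 0 / 2) {0..pi}"
        by (intro has_integral_divide Suc.IH)
      then show ?thesis
        by (simp add: 0 mult_ac)
    next
      case (Suc k)
      have "((\<lambda>\<theta>. (w \<theta> * (cos \<theta> ^ i * cheb_U (Suc (Suc k)) (cos \<theta>)) + w \<theta> * (cos \<theta> ^ i * cheb_U k (cos \<theta>))) / 2)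
          has_integral (0 + 0) / 2) {0..pi}"
        by (intro has_integral_divide has_integral_add Suc.IH)
      moreover have "(w \<theta> * (cos \<theta> ^ i * cheb_U (Suc (Suc k)) (cos \<theta>)) + w \<theta> * (cos \<theta> ^ i * cheb_U k (cos \<theta>))) / 2
          = w \<theta> * (cos \<theta> ^ Suc i * cheb_U n (cos \<theta>))" for \<theta>
        by (simp add: Suc algebra_simps)
      ultimately show ?thesis by simp
    qed
  qed
  have poly: "((\<lambda>\<theta>. w \<theta> * p (cos \<theta>)) has_integral 0) {0..pi}" if "real_polynomial_function p" for p
  proof -
    obtain a N where p: "p = (\<lambda>x. \<Sum>i\<le>N. a i * x ^ i)"
      using \<open>real_polynomial_function p\<close> unfolding real_polynomial_function_iff_sum by blast
    have "((\<lambda>\<theta>. \<Sum>i\<le>N. a i * (w \<theta> * (cos \<theta> ^ i * cheb_U 0 (cos \<theta>)))) has_integral (\<Sum>i\<le>N. a i * 0)) {0..pi}"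
      by (intro has_integral_sum has_integral_mult_right pow) simp
    then show ?thesis
      by (simp add: p sum_distrib_left mult_ac)
  qed
  define I where "I = integral {0..pi} (\<lambda>\<theta>. w \<theta> * D \<theta>)"
  define M where "M = integral {0..pi} (\<lambda>\<theta>. \<bar>w \<theta>\<bar>)"
  have int_I: "((\<lambda>\<theta>. w \<theta> * D \<theta>) has_integral I) {0..pi}"
    unfolding I_def by (intro integrable_integral integrable_continuous_real continuous_intros cw cont)
  have int_M: "((\<lambda>\<theta>. \<bar>w \<theta>\<bar>) has_integral M) {0..pi}"
    unfolding M_def by (intro integrable_integral integrable_continuous_real continuous_intros cw)
  have M0: "M \<ge> 0"
    unfolding M_def by (intro integral_nonneg integrable_continuous_real continuous_intros cw) simp
  have le: "I \<le> e * M" if "e > 0" for e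
  proof -
    have "continuous_on {-1..1} (\<lambda>t. D (arccos t))"
      by (rule continuous_on_compose2[OF cont continuous_on_arccos']) (auto simp: arccos_lbound arccos_ubound)
    then obtain p where p: "real_polynomial_function p" "\<And>t. t \<in> {-1..1} \<Longrightarrow> \<bar>D (arccos t) - p t\<bar> < e"
      using Stone_Weierstrass_real_polynomial_function[of "{-1..1::real}" "\<lambda>t. D (arccos t)" e] \<open>e > 0\<close> by auto
    have "((\<lambda>\<theta>. w \<theta> * D \<theta> - w \<theta> * p (cos \<theta>)) has_integral (I - 0)) {0..pi}"
      by (intro has_integral_diff int_I poly p)
    moreover have "((\<lambda>\<theta>. e * \<bar>w \<theta>\<bar>) has_integral e * M) {0..pi}"
      by (intro has_integral_mult_right int_M)
    moreover have "w \<theta> * D \<theta> - w \<theta> * p (cos \<theta>) \<le> e * \<bar>w \<theta>\<bar>" if "\<theta> \<in> {0..pi}" for \<theta>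
    proof -
      have "w \<theta> * (D \<theta> - p (cos \<theta>)) \<le> \<bar>w \<theta>\<bar> * \<bar>D \<theta> - p (cos \<theta>)\<bar>"
        unfolding abs_mult[symmetric] by simp
      also have "\<dots> \<le> \<bar>w \<theta>\<bar> * e"
      proof (rule mult_left_mono)
        show "\<bar>D \<theta> - p (cos \<theta>)\<bar> \<le> e"
          using p(2)[of "cos \<theta>"] that by (simp add: arccos_cos)
      qed simp
      finally show ?thesis
        by (simp add: algebra_simps)
    qed
    ultimately have "I - 0 \<le> e * M"
      by (rule has_integral_le)
    then show ?thesis by simp
  qed
  have "I \<le> 0"
  proof (rule field_le_epsilon)
    fix e :: real assume "e > 0"
    have "I \<le> e / (M + 1) * M"
      using \<open>e > 0\<close> M0 by (intro le) simp
    also have "\<dots> \<le> e"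
      using \<open>e > 0\<close> M0 by (simp add: field_simps)
    finally show "I \<le> 0 + e" by simp
  qed
  moreover have nn: "w x * D x \<ge> 0" for x
  proof -
    have "w x * D x = (D x * sin x)\<^sup>2"
      by (simp add: w_def power2_eq_square)
    then show ?thesis by simp
  qed
  moreover have "I \<ge> 0"
    unfolding I_def by (intro integral_nonneg integrable_continuous_real continuous_intros cw cont nn)
  ultimately have "I = 0" by simp
  then have "\<forall>x\<in>{0..pi}. w x * D x = 0"
    unfolding I_def using nn
    by (subst (asm) integral_eq_0_iff) (auto intro!: continuous_intros cw cont)
  then have D0: "D x = 0" if "x \<in> {0<..<pi}" for x
    using that sin_gt_zero[of x] by (force simp: w_def)
  \<comment> \<open>The weight vanishes at 0 and \<open>pi\<close>, so the values there are
    recovered by continuity.\<close>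
  show ?thesis
    by (rule continuous_constant_on_closure[of "{0<..<pi}"]) (use D0 cont \<theta> in auto)
qed

text \<open>The M-test with the bound \<open>n + 1\<close> for \<open>cheb_U\<close> makes the sum
  \<open>S\<close> continuous and allows termwise integration. By orthogonality \<open>S\<close> has
  the coefficients of \<open>f\<close>, and completeness identifies the two. The factor
  \<open>2 / pi\<close> is the reciprocal of the squared norm of a sine.\<close>

lemma sine_expansion:
  fixes f :: "real \<Rightarrow> real"
  assumes cont: "continuous_on {0..pi} f"
    and coeff: "\<And>m. ((\<lambda>\<theta>. f \<theta> * sin \<theta> * sin ((real m + 1) * \<theta>)) has_integral b m) {0..pi}"
    and summ: "summable (\<lambda>n. (real n + 1) * \<bar>b n\<bar>)"
    and \<theta>: "\<theta> \<in> {0..pi}"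
  shows "(\<lambda>n. 2 / pi * b n * cheb_U n (cos \<theta>)) sums f \<theta>"
proof -
  define g where "g = (\<lambda>n \<theta>. 2 / pi * b n * cheb_U n (cos \<theta>))"
  define S where "S = (\<lambda>\<theta>. \<Sum>n. g n \<theta>)"
  have summ': "summable (\<lambda>n. 2 / pi * ((real n + 1) * \<bar>b n\<bar>))"
    by (intro summable_mult summ)
  have bound: "\<bar>g n \<theta>\<bar> \<le> 2 / pi * ((real n + 1) * \<bar>b n\<bar>)" for n \<theta>
    using mult_left_mono[OF abs_cheb_U_cos_le[of n \<theta>], of "2 / pi * \<bar>b n\<bar>"]
    by (simp add: g_def abs_mult mult_ac)
  have gcont: "continuous_on {0..pi} (g n)" for n
    unfolding g_def by (intro continuous_intros)
  have Scont: "continuous_on {0..pi} S"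
    unfolding S_def
  proof (rule uniform_limit_theorem)
    show "uniform_limit {0..pi} (\<lambda>n x. \<Sum>i<n. g i x) (\<lambda>x. \<Sum>n. g n x) sequentially"
      by (rule Weierstrass_m_test[OF _ summ']) (use bound in auto)
  qed (auto intro!: always_eventually continuous_intros gcont)
  have g_sums: "(\<lambda>n. g n x) sums S x" for x
    unfolding S_def
    by (intro summable_sums summable_comparison_test[OF _ summ']) (use bound in auto)
  have Scoeff: "((\<lambda>\<theta>. S \<theta> * sin \<theta> * sin ((real m + 1) * \<theta>)) has_integral b m) {0..pi}" for m
  proof -
    define h where "h = (\<lambda>n \<theta>. g n \<theta> * sin \<theta> * sin ((real m + 1) * \<theta>))"
    have hbound: "\<bar>h n \<theta>\<bar> \<le> 2 / pi * ((real n + 1) * \<bar>b n\<bar>)" for n \<theta>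
    proof -
      have "\<bar>h n \<theta>\<bar> \<le> \<bar>g n \<theta>\<bar> * 1 * 1"
        unfolding h_def abs_mult by (intro mult_mono) auto
      with bound[of n \<theta>] show ?thesis by simp
    qed
    have hsum: "(\<Sum>n. h n x) = S x * sin x * sin ((real m + 1) * x)" for x
      unfolding h_def
      by (rule sums_unique[symmetric]) (intro sums_mult2 g_sums)
    have ul: "uniform_limit {0..pi} (\<lambda>n x. \<Sum>i<n. h i x) (\<lambda>x. \<Sum>n. h n x) sequentially"
      by (rule Weierstrass_m_test[OF _ summ']) (use hbound in auto)
    have hcont: "continuous_on {0..pi} (\<lambda>x. \<Sum>i<n. h i x)" for n
      unfolding h_def by (intro continuous_intros gcont)
    obtain I J where IJ: "\<And>n. ((\<lambda>x. \<Sum>i<n. h i x) has_integral I n) {0..pi}"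
      "((\<lambda>x. \<Sum>n. h n x) has_integral J) {0..pi}" "I \<longlonglongrightarrow> J"
      by (rule uniform_limit_integral[OF ul hcont sequentially_bot]) (rule that)
    have hint: "(h i has_integral (if i = m then b m else 0)) {0..pi}" for i
    proof -
      have 1: "((\<lambda>\<theta>. 2 / pi * b i * (sin ((real i + 1) * \<theta>) * sin ((real m + 1) * \<theta>))) has_integral
         2 / pi * b i * (if i = m then pi / 2 else 0)) {0..pi}"
        by (intro has_integral_mult_right sin_sin_orthogonal)
      have 2: "(\<lambda>\<theta>. 2 / pi * b i * (sin ((real i + 1) * \<theta>) * sin ((real m + 1) * \<theta>))) = h i"
        unfolding h_def g_def sin_cheb_U[of i] by (simp add: fun_eq_iff)
      have 3: "2 / pi * b i * (if i = m then pi / 2 else 0) = (if i = m then b m else 0)"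
        by simp
      show ?thesis
        using 1 unfolding 2 3 .
    qed
    have "I n = (\<Sum>i<n. if i = m then b m else 0)" for n
      by (rule has_integral_unique[OF IJ(1)]) (intro has_integral_sum hint; simp)
    then have "I n = b m" if "n > m" for n
      using that by simp
    then have "I \<longlonglongrightarrow> b m"
      by (intro tendsto_eventually) (auto simp: eventually_sequentially intro!: exI[of _ "Suc m"])
    then have "J = b m"
      using IJ(3) by (rule LIMSEQ_unique[rotated])
    with IJ(2) show ?thesis by (simp add: hsum)
  qed
  have "f \<theta> - S \<theta> = 0"
  proof (rule sine_complete[OF _ _ \<theta>])
    show "continuous_on {0..pi} (\<lambda>\<theta>. f \<theta> - S \<theta>)"
      by (intro continuous_intros cont Scont)
    show "((\<lambda>\<theta>. (f \<theta> - S \<theta>) * sin \<theta> * sin ((real m + 1) * \<theta>)) has_integral 0) {0..pi}" for m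
      using has_integral_diff[OF coeff[of m] Scoeff[of m]] by (simp add: algebra_simps)
  qed
  with g_sums[of \<theta>] show ?thesis by (simp add: g_def)
qed

section \<open>Positive definiteness of the overlap kernel\<close>

definition quad_form :: "'i set \<Rightarrow> ('i \<Rightarrow> real) \<Rightarrow> ('i \<Rightarrow> 'i \<Rightarrow> real) \<Rightarrow> real" where
  "quad_form I c h = (\<Sum>i\<in>I. \<Sum>j\<in>I. c i * c j * h i j)"

text \<open>The expansion in \<open>cheb_U\<close> has nonnegative coefficients, each term has a
  nonnegative quadratic form, and the finite double sum commutes with the series.\<close>

lemma cap_overlap_pd:
  fixes x :: "'i \<Rightarrow> real ^ 4"
  assumes r: "0 < r" "r \<le> pi / 2" and x: "\<And>i. i \<in> I \<Longrightarrow> norm (x i) = 1"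
  shows "quad_form I c (\<lambda>i j. cap_overlap r (arccos (x i \<bullet> x j))) \<ge> 0"
proof -
  define b where "b = (\<lambda>n. (cap_coeff n r)\<^sup>2 / (real n + 1))"
  have b0: "b n \<ge> 0" for n
    by (simp add: b_def)
  have "(\<lambda>n. 2 / pi * b n * cheb_U n (x i \<bullet> x j)) sums cap_overlap r (arccos (x i \<bullet> x j))"
    if "i \<in> I" "j \<in> I" for i j
  proof -
    have "\<bar>x i \<bullet> x j\<bar> \<le> 1"
      using Cauchy_Schwarz_ineq2[of "x i" "x j"] that x by simp
    then have *: "-1 \<le> x i \<bullet> x j" "x i \<bullet> x j \<le> 1" by auto
    have "(\<lambda>n. 2 / pi * b n * cheb_U n (cos (arccos (x i \<bullet> x j)))) sums cap_overlap r (arccos (x i \<bullet> x j))"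
    proof (rule sine_expansion)
      show "continuous_on {0..pi} (cap_overlap r)"
        by (rule continuous_on_cap_overlap[OF r])
      show "((\<lambda>\<theta>. cap_overlap r \<theta> * sin \<theta> * sin ((real m + 1) * \<theta>)) has_integral b m) {0..pi}" for m
        unfolding b_def by (rule cap_overlap_has_integral[OF r])
      show "summable (\<lambda>n. (real n + 1) * \<bar>b n\<bar>)"
        using summable_cap_coeff[of r] by (simp add: b_def abs_divide add_pos_nonneg)
    qed (use * in \<open>auto simp: arccos_lbound arccos_ubound\<close>)
    with * show ?thesis by (simp add: cos_arccos)
  qed
  then have 1: "(\<lambda>n. quad_form I c (\<lambda>i j. 2 / pi * b n * cheb_U n (x i \<bullet> x j))) sums
      quad_form I c (\<lambda>i j. cap_overlap r (arccos (x i \<bullet> x j)))"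
    unfolding quad_form_def by (intro sums_sum sums_mult)
  have 2: "0 \<le> quad_form I c (\<lambda>i j. 2 / pi * b n * cheb_U n (x i \<bullet> x j))" for n
  proof -
    have "quad_form I c (\<lambda>i j. 2 / pi * b n * cheb_U n (x i \<bullet> x j)) =
        2 / pi * b n * (\<Sum>i\<in>I. \<Sum>j\<in>I. c i * c j * cheb_U n (x i \<bullet> x j))"
      unfolding quad_form_def by (simp add: sum_distrib_left mult_ac)
    also have "\<dots> \<ge> 0"
      using b0 by (intro mult_nonneg_nonneg cheb_U_inner_nonneg x) auto
    finally show ?thesis .
  qed
  show ?thesis
    by (rule sums_le[OF 2 sums_zero 1])
qed

section \<open>Interpolation by hinges\<close>

text \<open>The radius satisfies \<open>(tan r)\<^sup>2 = a\<close>, and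
  \<open>1 + a = 1 / (cos r)\<^sup>2\<close> normalises the derivative to exactly minus a hinge in
  \<open>(tan (\<theta> / 2))\<^sup>2\<close>.\<close>

definition hinge_kernel :: "real \<Rightarrow> real \<Rightarrow> real" where
  "hinge_kernel a \<theta> = (1 + a) * cap_overlap (arctan (sqrt a)) \<theta>"

text \<open>At \<open>\<theta> = 2 * r\<close> the first branch and its derivative both vanish, so
  it glues differentiably with 0.\<close>

lemma cap_overlap_has_real_derivative:
  assumes r: "0 < r" "r < pi / 2" and \<theta>: "0 < \<theta>" "\<theta> < pi"
  shows "(cap_overlap r has_real_derivative - ((cos r)\<^sup>2 * max 0 ((tan r)\<^sup>2 - (tan (\<theta> / 2))\<^sup>2))) (at \<theta>)"
proof -
  define f where "f = (\<lambda>\<theta>. 2 * r - \<theta> - sin (2 * r) + 2 * (cos r)\<^sup>2 * tan (\<theta> / 2))"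
  define f' where "f' = (\<lambda>\<theta>. - ((cos r)\<^sup>2 * ((tan r)\<^sup>2 - (tan (\<theta> / 2))\<^sup>2)))"
  have cr: "cos r > 0" using r by (intro cos_gt_zero_pi) auto
  have tr: "1 = (cos r)\<^sup>2 + (cos r)\<^sup>2 * (tan r)\<^sup>2"
    using cr sin_cos_squared_add[of r] by (simp add: tan_def power_divide)
  have f2r: "f (2 * r) = 0"
    using cr by (simp add: f_def tan_def sin_double power2_eq_square)
  have f: "(f has_vector_derivative f' \<theta>) (at \<theta> within S)" for S
  proof -
    have "cos (\<theta> / 2) > 0" using \<theta> by (intro cos_gt_zero_pi) auto
    then have "(f has_real_derivative - 1 + (cos r)\<^sup>2 * (1 + (tan (\<theta> / 2))\<^sup>2)) (at \<theta>)"
      unfolding f_def by (auto intro!: derivative_eq_intros simp: tan_sec inverse_eq_divide power_divide)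
    also have "- 1 + (cos r)\<^sup>2 * (1 + (tan (\<theta> / 2))\<^sup>2) = f' \<theta>"
      using tr by (simp add: f'_def algebra_simps)
    finally show ?thesis
      by (simp add: has_real_derivative_iff_has_vector_derivative has_vector_derivative_at_within)
  qed
  have "((\<lambda>x. if x \<in> {..2 * r} then f x else 0) has_vector_derivative
     (if \<theta> \<in> {..2 * r} then f' \<theta> else 0)) (at \<theta> within UNIV)"
    by (rule has_vector_derivative_If_within_closures[where T = "{2 * r..}"])
      (use f f2r in \<open>auto simp: f'_def\<close>)
  moreover have "(\<lambda>x. if x \<in> {..2 * r} then f x else 0) = cap_overlap r"
    by (simp add: f_def cap_overlap_def fun_eq_iff)
  moreover have "(if \<theta> \<in> {..2 * r} then f' \<theta> else 0) =
     - ((cos r)\<^sup>2 * max 0 ((tan r)\<^sup>2 - (tan (\<theta> / 2))\<^sup>2))"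
  proof (cases "\<theta> \<le> 2 * r")
    case True
    have "tan (\<theta> / 2) \<le> tan r" "0 \<le> tan (\<theta> / 2)"
      using True r \<theta> by (auto intro: tan_mono_le order.strict_implies_order[OF tan_gt_zero])
    then have "(tan (\<theta> / 2))\<^sup>2 \<le> (tan r)\<^sup>2"
      by (intro power_mono)
    then show ?thesis using True by (simp add: f'_def max_def)
  next
    case False
    have "tan r \<le> tan (\<theta> / 2)" "0 \<le> tan r"
      using False r \<theta> by (auto intro: tan_mono_le order.strict_implies_order[OF tan_gt_zero])
    then have "(tan r)\<^sup>2 \<le> (tan (\<theta> / 2))\<^sup>2"
      by (intro power_mono)
    then show ?thesis using False by (simp add: max_def)
  qed
  ultimately show ?thesis
    by (simp add: has_real_derivative_iff_has_vector_derivative)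
qed

lemma arctan_sqrt_bounds:
  assumes "a > 0"
  shows "0 < arctan (sqrt a)" "arctan (sqrt a) < pi / 2"
  using assms arctan_ubound by (auto simp: zero_less_arctan_iff)

lemma hinge_kernel_has_real_derivative:
  assumes a: "a > 0" and \<theta>: "0 < \<theta>" "\<theta> < pi"
  shows "(hinge_kernel a has_real_derivative - max 0 (a - (tan (\<theta> / 2))\<^sup>2)) (at \<theta>)"
proof -
  have "(hinge_kernel a has_real_derivative
      (1 + a) * - ((cos (arctan (sqrt a)))\<^sup>2 * max 0 ((tan (arctan (sqrt a)))\<^sup>2 - (tan (\<theta> / 2))\<^sup>2))) (at \<theta>)"
    unfolding hinge_kernel_def
    by (intro DERIV_cmult cap_overlap_has_real_derivative arctan_sqrt_bounds a \<theta>)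
  then show ?thesis
    using a by (simp add: tan_arctan cos_arctan power_divide)
qed

lemma continuous_on_hinge_kernel: "a > 0 \<Longrightarrow> continuous_on {0..pi} (hinge_kernel a)"
  unfolding hinge_kernel_def
  using arctan_sqrt_bounds[of a] by (intro continuous_intros continuous_on_cap_overlap) auto

lemma hinge_kernel_pi: "a > 0 \<Longrightarrow> hinge_kernel a pi = 0"
  using arctan_sqrt_bounds[of a] by (simp add: hinge_kernel_def cap_overlap_def)

lemma quad_form_hinge_kernel_nonneg:
  fixes x :: "'i \<Rightarrow> real ^ 4"
  assumes "a > 0" "\<And>i. i \<in> I \<Longrightarrow> norm (x i) = 1"
  shows "quad_form I c (\<lambda>i j. hinge_kernel a (arccos (x i \<bullet> x j))) \<ge> 0"
proof -
  have "quad_form I c (\<lambda>i j. hinge_kernel a (arccos (x i \<bullet> x j))) =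
     (1 + a) * quad_form I c (\<lambda>i j. cap_overlap (arctan (sqrt a)) (arccos (x i \<bullet> x j)))"
    by (simp add: quad_form_def hinge_kernel_def sum_distrib_left mult_ac)
  also have "\<dots> \<ge> 0"
    using assms arctan_sqrt_bounds[of a]
    by (intro mult_nonneg_nonneg cap_overlap_pd) auto
  finally show ?thesis .
qed

lemma arccos_inner_mem:
  assumes "norm x = 1" "norm y = 1"
  shows "arccos (x \<bullet> y) \<in> {0..pi}"
proof -
  have "\<bar>x \<bullet> y\<bar> \<le> 1"
    using Cauchy_Schwarz_ineq2[of x y] assms by simp
  then show ?thesis by (auto simp: abs_le_iff intro: arccos_lbound arccos_ubound)
qed

text \<open>This is the overlap kernel of hemispheres. Its derivative is constant, so it accounts
  for the constant part of the interpolant.\<close>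

lemma quad_form_pi_minus_nonneg:
  fixes x :: "'i \<Rightarrow> real ^ 4"
  assumes "\<And>i. i \<in> I \<Longrightarrow> norm (x i) = 1"
  shows "quad_form I c (\<lambda>i j. pi - arccos (x i \<bullet> x j)) \<ge> 0"
proof -
  have "cap_overlap (pi / 2) \<theta> = pi - \<theta>" if "\<theta> \<in> {0..pi}" for \<theta>
    using that by (simp add: cap_overlap_def)
  then have "quad_form I c (\<lambda>i j. pi - arccos (x i \<bullet> x j)) =
      quad_form I c (\<lambda>i j. cap_overlap (pi / 2) (arccos (x i \<bullet> x j)))"
    unfolding quad_form_def by (intro sum.cong refl) (simp add: arccos_inner_mem assms del: atLeastAtMost_iff)
  then show ?thesis
    using cap_overlap_pd[of "pi / 2" I x c] assms by simp
qed

lemma quad_form_const_nonneg: "k \<ge> 0 \<Longrightarrow> quad_form I c (\<lambda>i j. k) \<ge> 0"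
proof -
  assume "k \<ge> 0"
  have "quad_form I c (\<lambda>i j. k) = k * (sum c I)\<^sup>2"
    by (simp add: quad_form_def power2_eq_square sum_product sum_distrib_left mult_ac)
  with \<open>k \<ge> 0\<close> show ?thesis by simp
qed

section \<open>Quadratic forms and summation by parts\<close>

lemma quad_form_add: "quad_form I c (\<lambda>i j. f i j + g i j) = quad_form I c f + quad_form I c g"
  by (simp add: quad_form_def algebra_simps sum.distrib)

lemma quad_form_cmult: "quad_form I c (\<lambda>i j. k * f i j) = k * quad_form I c f"
  by (simp add: quad_form_def sum_distrib_left mult_ac)

text \<open>Summation by parts turns this into \<open>D n * M (Suc n)\<close> plus the sum of
  \<open>(D k - D (Suc k)) * M (Suc k)\<close> over \<open>k < n\<close>: a nonnegative combination
  of values of \<open>M\<close> whenever \<open>D\<close> is nonnegative and nonincreasing.\<close>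

definition abel_sum :: "(nat \<Rightarrow> real) \<Rightarrow> (nat \<Rightarrow> real) \<Rightarrow> nat \<Rightarrow> real" where
  "abel_sum D M n = D 0 * M 1 + (\<Sum>k<n. D (Suc k) * (M (Suc (Suc k)) - M (Suc k)))"

lemma abel_sum_nonneg:
  assumes "\<And>k. D (Suc k) \<le> D k" "\<And>k. D k \<ge> 0" "\<And>k. M (Suc k) \<ge> 0"
  shows "abel_sum D M n \<ge> 0"
proof -
  have "abel_sum D M n \<ge> D n * M (Suc n)"
  proof (induction n)
    case (Suc n)
    have "D (Suc n) * M (Suc n) \<le> D n * M (Suc n)"
      by (intro mult_right_mono assms)
    with Suc show ?case by (simp add: abel_sum_def algebra_simps)
  qed (simp add: abel_sum_def)
  moreover have "D n * M (Suc n) \<ge> 0"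
    by (intro mult_nonneg_nonneg assms)
  ultimately show ?thesis by linarith
qed

lemma quad_form_abel_sum:
  "quad_form I c (\<lambda>i j. abel_sum D (\<lambda>k. f k i j) n) = abel_sum D (\<lambda>k. quad_form I c (f k)) n"
proof (induction n)
  case 0
  show ?case by (simp add: abel_sum_def quad_form_cmult)
next
  case (Suc n)
  have *: "abel_sum D M (Suc n) = abel_sum D M n + (D (Suc n) * M (Suc (Suc n)) + (- D (Suc n)) * M (Suc n))" for M
    by (simp add: abel_sum_def algebra_simps)
  show ?case
    unfolding * quad_form_add quad_form_cmult Suc ..
qed

lemma has_real_derivative_abel_sum:
  assumes "\<And>k. (f k has_real_derivative f' k) (at x)"
  shows "((\<lambda>x. abel_sum D (\<lambda>k. f k x) n) has_real_derivative abel_sum D f' n) (at x)"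
  unfolding abel_sum_def
  by (intro DERIV_add DERIV_cmult DERIV_sum DERIV_diff assms)

section \<open>Piecewise affine interpolation at equidistant nodes\<close>

text \<open>The slope with its sign reversed: for a nonincreasing convex \<open>G\<close> the
  sequence is nonnegative and nonincreasing, as \<open>abel_sum_nonneg\<close> demands.\<close>

definition secant :: "(real \<Rightarrow> real) \<Rightarrow> real \<Rightarrow> real \<Rightarrow> nat \<Rightarrow> real" where
  "secant G a h k = (G (a + real k * h) - G (a + real (Suc k) * h)) / h"

text \<open>\<open>abel_sum\<close> does not subtract a hinge from its first term, so the interpolant of \<open>G\<close> at the
  nodes \<open>a + k h\<close> continues affinely below \<open>a\<close>.\<close>

definition hinge_interp :: "(real \<Rightarrow> real) \<Rightarrow> real \<Rightarrow> real \<Rightarrow> nat \<Rightarrow> real \<Rightarrow> real" where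
  "hinge_interp G a h n u =
     G (a + real (Suc n) * h) + abel_sum (secant G a h) (\<lambda>k. max 0 (a + real k * h - u)) n"

lemma hinge_interp_0: "h > 0 \<Longrightarrow> hinge_interp G a h 0 u = G (a + h) + secant G a h 0 * max 0 (a + h - u)"
  by (simp add: hinge_interp_def abel_sum_def)

text \<open>Left of the old last node the new hinge difference equals \<open>h\<close>, and times
  the secant it exactly compensates the drop of the constant term. So a further node changes the
  interpolant only to the right.\<close>

lemma hinge_interp_Suc:
  assumes h: "h > 0"
  shows "hinge_interp G a h (Suc n) u =
    (if u \<le> a + real (Suc n) * h then hinge_interp G a h n u
     else hinge_interp G a h n u + (G (a + real (Suc (Suc n)) * h) - G (a + real (Suc n) * h))
        + secant G a h (Suc n) * max 0 (a + real (Suc (Suc n)) * h - u))"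
proof -
  have S: "abel_sum D M (Suc n) = abel_sum D M n + D (Suc n) * (M (Suc (Suc n)) - M (Suc n))" for D M
    by (simp add: abel_sum_def)
  show ?thesis
  proof (cases "u \<le> a + real (Suc n) * h")
    case True
    have "max 0 (a + real (Suc (Suc n)) * h - u) - max 0 (a + real (Suc n) * h - u) = h"
      using True h by (simp add: max_def algebra_simps)
    moreover have "secant G a h (Suc n) * h = G (a + real (Suc n) * h) - G (a + real (Suc (Suc n)) * h)"
      using h by (simp add: secant_def)
    ultimately show ?thesis
      using True unfolding hinge_interp_def S by simp
  next
    case False
    then have "max 0 (a + real (Suc n) * h - u) = 0" by simp
    then show ?thesis
      using False unfolding hinge_interp_def S by simp
  qed
qed

lemma hinge_interp_right:
  assumes h: "h > 0" and u: "u \<ge> a + real (Suc n) * h"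
  shows "hinge_interp G a h n u = G (a + real (Suc n) * h)"
proof -
  have "max 0 (a + real k * h - u) = 0" if "k \<le> Suc n" for k
  proof -
    have "real k * h \<le> real (Suc n) * h"
      using that h by (intro mult_right_mono) auto
    with u show ?thesis by simp
  qed
  then show ?thesis
    by (simp add: hinge_interp_def abel_sum_def del: of_nat_Suc)
qed

lemma hinge_interp_left:
  assumes h: "h > 0" and u: "u \<le> a + h"
  shows "hinge_interp G a h n u = G a + secant G a h 0 * (a - u)"
proof (induction n)
  case 0
  have "secant G a h 0 * (a + h - u) = secant G a h 0 * (a - u) + secant G a h 0 * h"
    by (simp add: algebra_simps)
  also have "secant G a h 0 * h = G a - G (a + h)"
    using h by (simp add: secant_def)
  finally show ?case
    using u h by (simp add: hinge_interp_0)
next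
  case (Suc n)
  have "a + h \<le> a + real (Suc n) * h"
    using h by (simp add: algebra_simps)
  with u have "u \<le> a + real (Suc n) * h" by linarith
  then show ?case
    using Suc h by (simp only: hinge_interp_Suc if_True)
qed

text \<open>This places the interpolant between the values of \<open>G\<close> at two neighbouring
  nodes around \<open>u\<close>. By monotonicity \<open>G u\<close> lies there too, so the error is
  at most the oscillation of \<open>G\<close> over one cell.\<close>

lemma hinge_interp_between:
  assumes h: "h > 0" and u: "a \<le> u" "u \<le> a + real (Suc n) * h"
    and anti: "\<And>u v. a \<le> u \<Longrightarrow> u \<le> v \<Longrightarrow> G v \<le> G u"
  shows "\<exists>k\<le>n. a + real k * h \<le> u \<and> u \<le> a + real (Suc k) * h \<and>
     G (a + real (Suc k) * h) \<le> hinge_interp G a h n u \<and> hinge_interp G a h n u \<le> G (a + real k * h)"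
  using u
proof (induction n)
  case (Suc n)
  show ?case
  proof (cases "u \<le> a + real (Suc n) * h")
    case True
    then show ?thesis
      using Suc h by (auto simp: hinge_interp_Suc simp del: of_nat_Suc intro: le_SucI)
  next
    case False
    let ?p = "a + real (Suc n) * h" and ?q = "a + real (Suc (Suc n)) * h"
    have q: "?q = ?p + h" by (simp add: algebra_simps)
    have eq: "hinge_interp G a h (Suc n) u = G ?q + secant G a h (Suc n) * (?q - u)"
      using False Suc.prems h by (simp only: hinge_interp_Suc hinge_interp_right if_False)
    have s: "secant G a h (Suc n) * h = G ?p - G ?q"
      using h by (simp add: secant_def)
    have "G ?q \<le> G ?p"
      using h q by (intro anti) (simp_all add: algebra_simps)
    then have s0: "secant G a h (Suc n) \<ge> 0"
      unfolding secant_def using h by simp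
    have "0 \<le> secant G a h (Suc n) * (?q - u)"
      using s0 Suc.prems by (intro mult_nonneg_nonneg) auto
    moreover have "secant G a h (Suc n) * (?q - u) \<le> secant G a h (Suc n) * h"
      using s0 False q by (intro mult_left_mono) auto
    ultimately have "G ?q \<le> hinge_interp G a h (Suc n) u \<and> hinge_interp G a h (Suc n) u \<le> G ?p"
      unfolding eq s by linarith
    then show ?thesis
      using False Suc.prems by (intro exI[of _ "Suc n"]) simp
  qed
next
  case 0
  have s: "secant G a h 0 * h = G a - G (a + h)"
    using h by (simp add: secant_def)
  have s0: "secant G a h 0 \<ge> 0"
    unfolding secant_def using h anti[of a "a + h"] by simp
  have "0 \<le> secant G a h 0 * (u - a)" "secant G a h 0 * (u - a) \<le> secant G a h 0 * h"
    using s0 0 h by (auto intro!: mult_nonneg_nonneg mult_left_mono)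
  then show ?case
    using 0 s hinge_interp_left[OF h, of u a G 0] by (simp add: algebra_simps)
qed

section \<open>Error and one-sided gap of the interpolation\<close>

lemma half_tan_sq_mono:
  assumes "0 \<le> s" "s \<le> t" "t < pi"
  shows "(tan (s / 2))\<^sup>2 \<le> (tan (t / 2))\<^sup>2"
proof (rule power_mono)
  show "tan (s / 2) \<le> tan (t / 2)" using assms by (intro tan_mono_le) auto
  show "0 \<le> tan (s / 2)" using assms by (cases "s = 0") (auto intro!: order.strict_implies_order tan_gt_zero)
qed

lemma convex_on_three_points:
  fixes G :: "real \<Rightarrow> real"
  assumes "convex_on {0<..} G" "0 < u" "u < p" "p < v"
  shows "(G p - G v) * (p - u) \<le> (G u - G p) * (v - p)"
proof -
  have "(G u - G p) / (u - p) \<le> (G p - G v) / (p - v)"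
    using convex_on_slope_le[OF assms(1), of u v p] assms by (auto intro: order.trans)
  then have "(G p - G v) / (v - p) \<le> (G u - G p) / (p - u)"
    by (metis minus_diff_eq minus_divide_right neg_le_iff_le)
  then show ?thesis
    using assms by (simp add: field_simps)
qed

lemma mvt_real:
  fixes f :: "real \<Rightarrow> real"
  assumes "a < b" "continuous_on {a..b} f" "\<And>x. a < x \<Longrightarrow> x < b \<Longrightarrow> (f has_real_derivative f' x) (at x)"
  obtains \<xi> where "a < \<xi>" "\<xi> < b" "f b - f a = f' \<xi> * (b - a)"
  using mvt[of a b f "\<lambda>x. (*) (f' x)"] assms unfolding has_field_derivative_def by blast

text \<open>Beyond a point \<open>A\<close> where \<open>G\<close> is within
  \<open>\<epsilon>\<close> of its infimum, the interpolant is the constant \<open>G A\<close>. On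
  the compact interval from \<open>a\<close> to \<open>A\<close>, uniform continuity supplies the
  mesh.\<close>

lemma hinge_interp_error:
  assumes conv: "convex_on {0<..} G"
    and anti: "\<And>u v. 0 < u \<Longrightarrow> u \<le> v \<Longrightarrow> G v \<le> G u"
    and nonneg: "\<And>u. 0 < u \<Longrightarrow> 0 \<le> G u"
    and a: "a > 0" and \<epsilon>: "\<epsilon> > 0"
  obtains h n where "h > 0"
    "\<And>u. a \<le> u \<Longrightarrow> \<bar>hinge_interp G a h n u - G u\<bar> \<le> \<epsilon>"
proof -
  define L where "L = Inf (G ` {0<..})"
  have bdd: "bdd_below (G ` {0<..})"
    using nonneg by (intro bdd_belowI[of _ 0]) auto
  have L: "L \<le> G u" if "u > 0" for u
    unfolding L_def using that by (intro cInf_lower bdd) auto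
  have "\<exists>y\<in>G ` {0<..}. y < L + \<epsilon>"
    using cInf_lessD[of "G ` {0<..}" "L + \<epsilon>"] \<epsilon> unfolding L_def by auto
  then obtain A0 where A0: "A0 > 0" "G A0 < L + \<epsilon>" by auto
  define A where "A = max A0 (a + 1)"
  have A: "A > a" "A > 0" "G A < L + \<epsilon>"
    using A0 a anti[of A0 A] by (auto simp: A_def)
  have "continuous_on {0<..} G"
    by (rule convex_on_continuous) (auto simp: conv)
  then have "continuous_on {a..A} G"
    by (rule continuous_on_subset) (use a in auto)
  then have "uniformly_continuous_on {a..A} G"
    by (intro compact_uniformly_continuous) auto
  then obtain \<delta> where \<delta>: "\<delta> > 0" "\<And>u v. u \<in> {a..A} \<Longrightarrow> v \<in> {a..A} \<Longrightarrow> dist v u < \<delta> \<Longrightarrow> dist (G v) (G u) < \<epsilon>"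
    unfolding uniformly_continuous_on_def using \<epsilon> by metis
  \<comment> \<open>There are \<open>n + 1\<close> cells, so that the last node is exactly
    \<open>A\<close> and the mesh is below \<open>\<delta>\<close>.\<close>
  obtain n where n: "(A - a) / \<delta> < real (Suc n)"
    using reals_Archimedean2[of "(A - a) / \<delta>"] by (metis less_Suc_eq of_nat_less_iff order.strict_trans)
  define h where "h = (A - a) / real (Suc n)"
  have h: "h > 0" using A by (simp add: h_def)
  have h\<delta>: "h < \<delta>"
    unfolding h_def using n \<delta>(1) by (simp add: field_simps)
  have An: "a + real (Suc n) * h = A"
    by (simp add: h_def del: of_nat_Suc)
  have "\<bar>hinge_interp G a h n u - G u\<bar> \<le> \<epsilon>" if u: "a \<le> u" for u
  proof (cases "u \<le> A")
    case True
    then obtain k where k: "k \<le> n" "a + real k * h \<le> u" "u \<le> a + real (Suc k) * h"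
      "G (a + real (Suc k) * h) \<le> hinge_interp G a h n u" "hinge_interp G a h n u \<le> G (a + real k * h)"
      using hinge_interp_between[of h a u n G] h u An anti a by (auto simp del: of_nat_Suc)
    let ?p = "a + real k * h" and ?q = "a + real (Suc k) * h"
    have "real (Suc k) * h \<le> real (Suc n) * h"
      using k(1) h by (intro mult_right_mono) auto
    then have "?q \<le> A" using An by linarith
    moreover have pq: "?q = ?p + h" by (simp add: algebra_simps)
    moreover have ap: "a \<le> ?p" using h by simp
    ultimately have "dist (G ?q) (G ?p) < \<epsilon>"
      using h h\<delta> by (intro \<delta>(2)) (auto simp: dist_real_def)
    moreover have "G u \<le> G ?p" "G ?q \<le> G u"
      using k a ap by (auto intro!: anti simp del: of_nat_Suc)
    ultimately show ?thesis
      using k(4,5) unfolding dist_real_def by linarith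
  next
    case False
    then have "hinge_interp G a h n u = G A"
      using hinge_interp_right[OF h, of a n u G] by (simp only: An)
    moreover have "G u \<le> G A" "L \<le> G u"
      using False A by (auto intro!: anti L)
    ultimately show ?thesis using A(3) by simp
  qed
  with h show ?thesis by (rule that)
qed

text \<open>Below \<open>a\<close> the interpolant prolongs the chord over the first cell, which a
  convex \<open>G\<close> dominates. Up to \<open>a / 3\<close> the difference is at least a second
  difference of \<open>G\<close>, which does not depend on the mesh.\<close>

lemma hinge_interp_gap:
  assumes conv: "convex_on {0<..} G"
    and a: "a > 0" and h: "h > 0" and u: "0 < u" "u < a"
  shows "hinge_interp G a h n u \<le> G u"
    and "u \<le> a / 3 \<Longrightarrow> G (a / 3) - 2 * G (2 * a / 3) + G a \<le> G u - hinge_interp G a h n u"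
proof -
  have D: "secant G a h 0 = (G a - G (a + h)) / h"
    by (simp add: secant_def)
  have left: "hinge_interp G a h n u = G a + secant G a h 0 * (a - u)"
    using u h by (intro hinge_interp_left) auto
  have slope: "secant G a h 0 * (a - v) \<le> G v - G a" if "0 < v" "v < a" for v
    using convex_on_three_points[OF conv, of v a "a + h"] that h by (simp add: D field_simps)
  show "hinge_interp G a h n u \<le> G u"
    using slope[OF u] left by linarith
  assume u3: "u \<le> a / 3"
  \<comment> \<open>The bound over the last third of the interval, doubled, controls the prolonged
    chord between \<open>a / 3\<close> and \<open>a\<close>.\<close>
  have "secant G a h 0 * (a - 2 * a / 3) \<le> G (2 * a / 3) - G a"
    using a by (intro slope) auto
  then have 1: "secant G a h 0 * (2 * a / 3) \<le> 2 * G (2 * a / 3) - 2 * G a"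
    by (simp add: field_simps)
  \<comment> \<open>Left of \<open>a / 3\<close>, \<open>G\<close> falls at least as steeply as its
    chord from \<open>a / 3\<close> to \<open>a\<close>, and this chord at least as steeply as the
    interpolant.\<close>
  have "(G (a / 3) - G a) * (a / 3 - u) \<le> (G u - G (a / 3)) * (2 * a / 3)"
  proof (cases "u = a / 3")
    case True
    show ?thesis unfolding True by simp
  next
    case False
    then show ?thesis
      using convex_on_three_points[OF conv, of u "a / 3" a] u u3 a by (simp add: field_simps)
  qed
  moreover have "secant G a h 0 * (2 * a / 3) \<le> G (a / 3) - G a"
    using slope[of "a / 3"] a by (simp add: field_simps)
  then have "secant G a h 0 * (2 * a / 3) * (a / 3 - u) \<le> (G (a / 3) - G a) * (a / 3 - u)"
    using u3 by (intro mult_right_mono) auto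
  ultimately have "secant G a h 0 * (2 * a / 3) * (a / 3 - u) \<le> (G u - G (a / 3)) * (2 * a / 3)"
    by (rule order.trans[rotated])
  then have "(secant G a h 0 * (a / 3 - u)) * (2 * a / 3) \<le> (G u - G (a / 3)) * (2 * a / 3)"
    by (simp only: mult_ac)
  then have "secant G a h 0 * (a / 3 - u) \<le> G u - G (a / 3)"
    using a by (subst (asm) mult_le_cancel_right_pos) auto
  then have "secant G a h 0 * (a - u) - secant G a h 0 * (2 * a / 3) \<le> G u - G (a / 3)"
    by (simp add: algebra_simps)
  with 1 show "G (a / 3) - 2 * G (2 * a / 3) + G a \<le> G u - hinge_interp G a h n u"
    unfolding left by linarith
qed

text \<open>Integrating the negated interpolant from \<open>pi\<close> gives a constant, a multiple
  of \<open>pi - \<theta>\<close> and an \<open>abel_sum\<close> of hinge kernels. Convexity makes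
  the secants nonincreasing, so every part has a nonnegative quadratic form.\<close>

lemma hinge_approximant:
  fixes x :: "'i \<Rightarrow> real ^ 4"
  assumes conv: "convex_on {0<..} G"
    and anti: "\<And>u v. 0 < u \<Longrightarrow> u \<le> v \<Longrightarrow> G v \<le> G u"
    and nonneg: "\<And>u. 0 < u \<Longrightarrow> 0 \<le> G u"
    and a: "a > 0" and h: "h > 0" and b: "b \<ge> 0"
    and x: "\<And>i. i \<in> I \<Longrightarrow> norm (x i) = 1"
  obtains \<psi> where "continuous_on {0..pi} \<psi>" "\<psi> pi = b"
    "\<And>\<theta>. 0 < \<theta> \<Longrightarrow> \<theta> < pi \<Longrightarrow> (\<psi> has_real_derivative - hinge_interp G a h n ((tan (\<theta> / 2))\<^sup>2)) (at \<theta>)"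
    "quad_form I c (\<lambda>i j. \<psi> (arccos (x i \<bullet> x j))) \<ge> 0"
proof
  define node where "node = (\<lambda>k. a + real k * h)"
  have node: "node k > 0" for k
    using a h by (simp add: node_def add_pos_nonneg)
  let ?B = "G (a + real (Suc n) * h)"
  have B: "?B \<ge> 0"
    using nonneg[OF node[of "Suc n"]] by (simp add: node_def)
  define \<psi> where "\<psi> = (\<lambda>\<theta>. b + (?B * (pi - \<theta>) + abel_sum (secant G a h) (\<lambda>k. hinge_kernel (node k) \<theta>) n))"
  show "continuous_on {0..pi} \<psi>"
    unfolding \<psi>_def abel_sum_def by (intro continuous_intros continuous_on_hinge_kernel node)
  show "\<psi> pi = b"
    by (simp add: \<psi>_def abel_sum_def hinge_kernel_pi node)
  show "(\<psi> has_real_derivative - hinge_interp G a h n ((tan (\<theta> / 2))\<^sup>2)) (at \<theta>)"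
    if \<theta>: "0 < \<theta>" "\<theta> < pi" for \<theta>
  proof -
    have "((\<lambda>\<theta>. b + ?B * (pi - \<theta>)) has_real_derivative - ?B) (at \<theta>)"
      by (auto intro!: derivative_eq_intros)
    moreover have "((\<lambda>\<theta>. abel_sum (secant G a h) (\<lambda>k. hinge_kernel (node k) \<theta>) n) has_real_derivative
        abel_sum (secant G a h) (\<lambda>k. - max 0 (node k - (tan (\<theta> / 2))\<^sup>2)) n) (at \<theta>)"
      by (intro has_real_derivative_abel_sum hinge_kernel_has_real_derivative node \<theta>)
    moreover have "abel_sum D (\<lambda>k. - M k) n = - abel_sum D M n" for D M
      by (simp add: abel_sum_def sum_negf[symmetric] algebra_simps)
    ultimately show ?thesis
      using DERIV_add unfolding \<psi>_def hinge_interp_def node_def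
      by (fastforce simp: add.assoc)
  qed
  have "secant G a h (Suc k) \<le> secant G a h k" for k
  proof -
    have "(G (node (Suc k)) - G (node (Suc (Suc k)))) * (node (Suc k) - node k) \<le>
        (G (node k) - G (node (Suc k))) * (node (Suc (Suc k)) - node (Suc k))"
      using h node[of k] by (intro convex_on_three_points[OF conv]) (auto simp: node_def)
    moreover have "node (Suc k) - node k = h" "node (Suc (Suc k)) - node (Suc k) = h"
      by (simp_all add: node_def algebra_simps)
    ultimately show ?thesis
      using h unfolding secant_def node_def by (simp add: divide_right_mono)
  qed
  moreover have "secant G a h k \<ge> 0" for k
    using anti[OF node[of k], of "node (Suc k)"] h by (simp add: secant_def node_def)
  ultimately have "abel_sum (secant G a h) (\<lambda>k. quad_form I c (\<lambda>i j. hinge_kernel (node k) (arccos (x i \<bullet> x j)))) n \<ge> 0"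
    using x node by (intro abel_sum_nonneg quad_form_hinge_kernel_nonneg) auto
  then show "quad_form I c (\<lambda>i j. \<psi> (arccos (x i \<bullet> x j))) \<ge> 0"
    unfolding \<psi>_def quad_form_add quad_form_cmult quad_form_abel_sum
    using b B x by (intro add_nonneg_nonneg mult_nonneg_nonneg quad_form_const_nonneg quad_form_pi_minus_nonneg) auto
qed

section \<open>Strict positive definiteness\<close>

text \<open>Split \<open>\<phi>\<close> into a hinge approximant \<open>\<psi>\<close> with the same
  value at \<open>pi\<close> and a remainder \<open>E\<close>. The form of \<open>\<psi>\<close> is
  nonnegative. \<open>E\<close> is at most \<open>\<epsilon> * pi\<close> in size at the angles
  between distinct points but at least \<open>\<eta> - \<epsilon> * pi\<close> at 0, so its form is
  at least \<open>\<eta> * \<kappa> - \<epsilon> * pi * C\<close>.\<close>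

lemma quad_form_pos_of_convex:
  fixes x :: "'i \<Rightarrow> real ^ 4" and \<phi> G :: "real \<Rightarrow> real"
  assumes I: "finite I" and x: "\<And>i. i \<in> I \<Longrightarrow> norm (x i) = 1" and inj: "inj_on x I"
    and i0: "i0 \<in> I" "c i0 \<noteq> 0"
    and cont: "continuous_on {0..pi} \<phi>" and \<phi>pi: "\<phi> pi \<ge> 0"
    and deriv: "\<And>\<theta>. 0 < \<theta> \<Longrightarrow> \<theta> < pi \<Longrightarrow> (\<phi> has_real_derivative - G ((tan (\<theta> / 2))\<^sup>2)) (at \<theta>)"
    and conv: "convex_on {0<..} G"
    and anti: "\<And>u v. 0 < u \<Longrightarrow> u \<le> v \<Longrightarrow> G v \<le> G u"
    and nonneg: "\<And>u. 0 < u \<Longrightarrow> 0 \<le> G u"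
    and u1: "u1 > 0"
    and strict: "\<And>u p v. 0 < u \<Longrightarrow> u < p \<Longrightarrow> p < v \<Longrightarrow> v \<le> u1 \<Longrightarrow> (G p - G v) * (p - u) < (G u - G p) * (v - p)"
  shows "quad_form I c (\<lambda>i j. \<phi> (arccos (x i \<bullet> x j))) > 0"
proof -
  let ?\<theta> = "\<lambda>i j. arccos (x i \<bullet> x j)"
  have ang: "?\<theta> i j \<in> {0..pi}" if "i \<in> I" "j \<in> I" for i j
    using that by (intro arccos_inner_mem x)
  have ang_pos: "?\<theta> i j > 0" if "i \<in> I" "j \<in> I" "i \<noteq> j" for i j
  proof (rule ccontr)
    assume "\<not> ?\<theta> i j > 0"
    then have "?\<theta> i j = 0" using ang[OF that(1,2)] by simp
    moreover have "\<bar>x i \<bullet> x j\<bar> \<le> 1"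
      using Cauchy_Schwarz_ineq2[of "x i" "x j"] x that by simp
    ultimately have "x i \<bullet> x j = 1"
      using cos_arccos_abs[of "x i \<bullet> x j"] by simp
    then have "(x i - x j) \<bullet> (x i - x j) = 0"
      using x[OF that(1)] x[OF that(2)] by (simp add: inner_diff norm_eq_1 inner_commute)
    then show False
      using inj that by (auto dest: inj_onD)
  qed
  have diag: "?\<theta> i i = 0" if "i \<in> I" for i
    using x[OF that] by (simp add: norm_eq_1)
  \<comment> \<open>All angles between distinct points, and the angle belonging to
    \<open>u1\<close>, which confines \<open>a\<close> to the range of strict convexity and keeps
    \<open>\<theta>0\<close> below \<open>pi\<close>.\<close>
  define T where "T = insert (2 * arctan (sqrt u1)) ((\<lambda>(i, j). ?\<theta> i j) ` {(i, j) \<in> I \<times> I. i \<noteq> j})"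
  define \<theta>0 where "\<theta>0 = Min T"
  have "finite {(i, j) \<in> I \<times> I. i \<noteq> j}"
    by (rule finite_subset[of _ "I \<times> I"]) (use I in auto)
  then have T: "finite T" "T \<noteq> {}"
    by (simp_all add: T_def)
  have "\<forall>t\<in>T. t > 0"
    using ang_pos arctan_sqrt_bounds[OF u1] by (auto simp: T_def)
  then have \<theta>0_pos: "\<theta>0 > 0"
    unfolding \<theta>0_def using T by simp
  have \<theta>0_le: "\<theta>0 \<le> t" if "t \<in> T" for t
    unfolding \<theta>0_def using T that by simp
  have \<theta>0_le_u1: "\<theta>0 \<le> 2 * arctan (sqrt u1)"
    by (rule \<theta>0_le) (simp add: T_def)
  have \<theta>0_le_ang: "\<theta>0 \<le> ?\<theta> i j" if "i \<in> I" "j \<in> I" "i \<noteq> j" for i j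
    using that unfolding T_def by (intro \<theta>0_le[unfolded T_def] insertI2 image_eqI[where x = "(i, j)"]) auto
  have \<theta>0_pi: "\<theta>0 < pi"
    using \<theta>0_le_u1 arctan_sqrt_bounds[OF u1] by linarith
  define a where "a = (tan (\<theta>0 / 2))\<^sup>2"
  have tan\<theta>0: "tan (\<theta>0 / 2) > 0"
    using \<theta>0_pos \<theta>0_pi by (intro tan_gt_zero) auto
  then have a: "a > 0" by (simp add: a_def)
  have sqrt_a: "sqrt a = tan (\<theta>0 / 2)"
    using tan\<theta>0 by (simp add: a_def)
  have "a \<le> (tan ((2 * arctan (sqrt u1)) / 2))\<^sup>2"
    unfolding a_def using \<theta>0_pos \<theta>0_le_u1 arctan_sqrt_bounds[OF u1] by (intro half_tan_sq_mono) auto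
  then have au1: "a \<le> u1" using u1 by (simp add: tan_arctan)
  \<comment> \<open>The angle at which \<open>(tan (\<theta> / 2))\<^sup>2\<close> equals
    \<open>a / 3\<close>; up to it the second bound of \<open>hinge_interp_gap\<close>
    applies.\<close>
  define \<theta>p where "\<theta>p = 2 * arctan (sqrt (a / 3))"
  have \<theta>p_pos: "\<theta>p > 0"
    unfolding \<theta>p_def using arctan_sqrt_bounds[of "a / 3"] a by simp
  have "arctan (sqrt (a / 3)) < arctan (sqrt a)"
    using a by (intro arctan_monotone) simp
  also have "arctan (sqrt a) = \<theta>0 / 2"
    unfolding sqrt_a using \<theta>0_pos \<theta>0_pi by (intro arctan_tan) auto
  finally have \<theta>p_less: "\<theta>p < \<theta>0"
    by (simp add: \<theta>p_def)
  define \<eta> where "\<eta> = (G (a / 3) - 2 * G (2 * a / 3) + G a) * \<theta>p"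
  have "(G (2 * a / 3) - G a) * (2 * a / 3 - a / 3) < (G (a / 3) - G (2 * a / 3)) * (a - 2 * a / 3)"
    using a au1 by (intro strict) auto
  then have "(G (2 * a / 3) - G a) * (a / 3) < (G (a / 3) - G (2 * a / 3)) * (a / 3)"
    by (simp add: field_simps)
  then have "G (2 * a / 3) - G a < G (a / 3) - G (2 * a / 3)"
    using a by (subst (asm) mult_less_cancel_right_pos) auto
  then have gap: "G (a / 3) - 2 * G (2 * a / 3) + G a > 0"
    by simp
  then have \<eta>: "\<eta> > 0"
    unfolding \<eta>_def using \<theta>p_pos by (rule mult_pos_pos)
  define \<kappa> where "\<kappa> = (\<Sum>i\<in>I. (c i)\<^sup>2)"
  have \<kappa>: "\<kappa> > 0"
    unfolding \<kappa>_def using i0 I by (intro sum_pos2[of I i0]) auto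
  define C where "C = (\<Sum>i\<in>I. \<bar>c i\<bar>)\<^sup>2"
  have C: "C \<ge> 0" by (simp add: C_def)
  \<comment> \<open>Chosen so that the total error \<open>\<epsilon> * pi * C\<close> stays below
    the diagonal surplus \<open>\<eta> * \<kappa>\<close>.\<close>
  define \<epsilon> where "\<epsilon> = \<eta> * \<kappa> / (pi * (C + 1))"
  have \<epsilon>: "\<epsilon> > 0" using \<eta> \<kappa> C by (simp add: \<epsilon>_def)
  have "\<epsilon> * pi * C = \<eta> * \<kappa> * (C / (C + 1))"
    using C by (simp add: \<epsilon>_def)
  also have "\<dots> < \<eta> * \<kappa> * 1"
    using \<eta> \<kappa> C by (intro mult_strict_left_mono) auto
  finally have small: "\<epsilon> * pi * C < \<eta> * \<kappa>" by simp
  \<comment> \<open>The mesh can be chosen last because \<open>\<eta>\<close> depends on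
    \<open>a\<close> and \<open>G\<close> only.\<close>
  obtain h n where h: "h > 0" and
    err: "\<And>u. a \<le> u \<Longrightarrow> \<bar>hinge_interp G a h n u - G u\<bar> \<le> \<epsilon>"
    using hinge_interp_error[OF conv anti nonneg a \<epsilon>] by metis
  obtain \<psi> where \<psi>: "continuous_on {0..pi} \<psi>" "\<psi> pi = \<phi> pi"
    "\<And>\<theta>. 0 < \<theta> \<Longrightarrow> \<theta> < pi \<Longrightarrow> (\<psi> has_real_derivative - hinge_interp G a h n ((tan (\<theta> / 2))\<^sup>2)) (at \<theta>)"
    "quad_form I c (\<lambda>i j. \<psi> (?\<theta> i j)) \<ge> 0"
  proof (rule hinge_approximant[where I = I and x = x and n = n and c = c, OF conv _ _ a h \<phi>pi])
    show "G v \<le> G u" if "0 < u" "u \<le> v" for u v using that by (rule anti)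
    show "0 \<le> G u" if "0 < u" for u using that by (rule nonneg)
    show "norm (x i) = 1" if "i \<in> I" for i using that by (rule x)
  qed (rule that)
  define E where "E = (\<lambda>\<theta>. \<phi> \<theta> - \<psi> \<theta>)"
  define e where "e = (\<lambda>\<theta>. hinge_interp G a h n ((tan (\<theta> / 2))\<^sup>2) - G ((tan (\<theta> / 2))\<^sup>2))"
  have E_cont: "continuous_on {0..pi} E"
    unfolding E_def by (intro continuous_intros cont \<psi>)
  have E_deriv: "(E has_real_derivative e \<theta>) (at \<theta>)" if "0 < \<theta>" "\<theta> < pi" for \<theta>
    using DERIV_diff[OF deriv[OF that] \<psi>(3)[OF that]] by (simp add: E_def e_def)
  have E_mvt: "\<exists>\<xi>. s < \<xi> \<and> \<xi> < t \<and> E t - E s = e \<xi> * (t - s)" if st: "0 \<le> s" "s < t" "t \<le> pi" for s t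
  proof -
    have "continuous_on {s..t} E"
      using E_cont by (rule continuous_on_subset) (use st in auto)
    then obtain \<xi> where "s < \<xi>" "\<xi> < t" "E t - E s = e \<xi> * (t - s)"
      by (rule mvt_real[OF st(2)]) (use st E_deriv in auto)
    then show ?thesis by blast
  qed
  have E_far: "\<bar>E \<theta>\<bar> \<le> \<epsilon> * pi" if \<theta>: "\<theta>0 \<le> \<theta>" "\<theta> \<le> pi" for \<theta>
  proof (cases "\<theta> = pi")
    case True
    then show ?thesis using \<psi>(2) \<epsilon> by (simp add: E_def)
  next
    case False
    then obtain \<xi> where \<xi>: "\<theta> < \<xi>" "\<xi> < pi" "E pi - E \<theta> = e \<xi> * (pi - \<theta>)"
      using E_mvt[of \<theta> pi] \<theta> \<theta>0_pos by auto
    have "a \<le> (tan (\<xi> / 2))\<^sup>2"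
      unfolding a_def using \<xi> that \<theta>0_pos by (intro half_tan_sq_mono) auto
    then have "\<bar>e \<xi>\<bar> \<le> \<epsilon>"
      unfolding e_def by (rule err)
    moreover have "\<bar>E \<theta>\<bar> = \<bar>e \<xi>\<bar> * (pi - \<theta>)"
    proof -
      have "E pi = 0" using \<psi>(2) by (simp add: E_def)
      then have "\<bar>E \<theta>\<bar> = \<bar>e \<xi> * (pi - \<theta>)\<bar>" using \<xi>(3) by simp
      then show ?thesis using \<xi> by (simp add: abs_mult)
    qed
    ultimately show ?thesis
      using that \<theta>0_pos \<epsilon> by (auto intro!: mult_mono)
  qed
  have near: "0 < (tan (\<xi> / 2))\<^sup>2 \<and> (tan (\<xi> / 2))\<^sup>2 < a" if "0 < \<xi>" "\<xi> < \<theta>0" for \<xi>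
  proof -
    have "0 < tan (\<xi> / 2)" using that \<theta>0_pi by (intro tan_gt_zero) auto
    moreover have "tan (\<xi> / 2) < tan (\<theta>0 / 2)"
      using that \<theta>0_pi by (intro tan_monotone) auto
    ultimately show ?thesis
      unfolding a_def by (simp add: power_strict_mono)
  qed
  \<comment> \<open>Going from \<open>\<theta>0\<close> down to 0, \<open>E\<close> never decreases,
    and between \<open>\<theta>p\<close> and 0 it gains at least \<open>\<eta>\<close>.\<close>
  have E_0: "E 0 \<ge> \<eta> - \<epsilon> * pi"
  proof -
    obtain \<xi> where \<xi>: "0 < \<xi>" "\<xi> < \<theta>p" "E \<theta>p - E 0 = e \<xi> * (\<theta>p - 0)"
      using E_mvt[of 0 \<theta>p] \<theta>p_pos \<theta>p_less \<theta>0_pi by auto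
    obtain \<zeta> where \<zeta>: "\<theta>p < \<zeta>" "\<zeta> < \<theta>0" "E \<theta>0 - E \<theta>p = e \<zeta> * (\<theta>0 - \<theta>p)"
      using E_mvt[of \<theta>p \<theta>0] \<theta>p_pos \<theta>p_less \<theta>0_pi by auto
    have "(tan (\<xi> / 2))\<^sup>2 \<le> (tan (\<theta>p / 2))\<^sup>2"
      using \<xi> \<theta>p_less \<theta>0_pi by (intro half_tan_sq_mono) auto
    also have "\<dots> = a / 3"
      using a by (simp add: \<theta>p_def tan_arctan)
    finally have "G (a / 3) - 2 * G (2 * a / 3) + G a \<le> - e \<xi>"
      using hinge_interp_gap(2)[OF conv a h, of "(tan (\<xi> / 2))\<^sup>2" n] near[of \<xi>] \<xi> \<theta>p_less
      by (simp add: e_def)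
    then have "\<eta> \<le> - e \<xi> * \<theta>p"
      unfolding \<eta>_def using \<theta>p_pos by (intro mult_right_mono) auto
    moreover have "e \<zeta> \<le> 0"
      using hinge_interp_gap(1)[OF conv a h, of "(tan (\<zeta> / 2))\<^sup>2" n] near[of \<zeta>] \<zeta> \<theta>p_pos
      by (simp add: e_def)
    then have "e \<zeta> * (\<theta>0 - \<theta>p) \<le> 0"
      using \<theta>p_less by (simp add: mult_nonpos_nonneg)
    moreover have "\<bar>E \<theta>0\<bar> \<le> \<epsilon> * pi"
      using \<theta>0_pi by (intro E_far) auto
    ultimately show ?thesis
      using \<xi>(3) \<zeta>(3) by simp
  qed
  \<comment> \<open>The error \<open>\<epsilon> * pi\<close> is charged to all pairs alike, the
    diagonal ones included, so that it sums to a multiple of \<open>C\<close>.\<close>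
  have "quad_form I c (\<lambda>i j. E (?\<theta> i j)) \<ge> (\<Sum>i\<in>I. \<Sum>j\<in>I. (if i = j then (c i)\<^sup>2 * \<eta> else 0) - \<epsilon> * pi * (\<bar>c i\<bar> * \<bar>c j\<bar>))"
    unfolding quad_form_def
  proof (intro sum_mono)
    fix i j assume ij: "i \<in> I" "j \<in> I"
    show "(if i = j then (c i)\<^sup>2 * \<eta> else 0) - \<epsilon> * pi * (\<bar>c i\<bar> * \<bar>c j\<bar>) \<le> c i * c j * E (?\<theta> i j)"
    proof (cases "i = j")
      case True
      have "(c i)\<^sup>2 * (\<eta> - \<epsilon> * pi) \<le> (c i)\<^sup>2 * E 0"
        by (intro mult_left_mono E_0) simp
      then show ?thesis
        using True ij diag by (simp add: power2_eq_square algebra_simps)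
    next
      case False
      have "\<bar>c i * c j * E (?\<theta> i j)\<bar> \<le> (\<bar>c i\<bar> * \<bar>c j\<bar>) * (\<epsilon> * pi)"
        unfolding abs_mult using False ij \<theta>0_le_ang ang[OF ij] by (intro mult_left_mono E_far) auto
      then show ?thesis
        using False by (simp add: mult_ac abs_le_iff)
    qed
  qed
  also have "(\<Sum>i\<in>I. \<Sum>j\<in>I. (if i = j then (c i)\<^sup>2 * \<eta> else 0) - \<epsilon> * pi * (\<bar>c i\<bar> * \<bar>c j\<bar>)) = \<eta> * \<kappa> - \<epsilon> * pi * C"
  proof -
    have "(\<Sum>i\<in>I. \<Sum>j\<in>I. (if i = j then (c i)\<^sup>2 * \<eta> else 0)) = \<eta> * \<kappa>"
      using I by (simp add: \<kappa>_def sum_distrib_left mult.commute)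
    moreover have "(\<Sum>i\<in>I. \<Sum>j\<in>I. \<epsilon> * pi * (\<bar>c i\<bar> * \<bar>c j\<bar>)) = \<epsilon> * pi * C"
      by (simp only: C_def power2_eq_square sum_product) (simp only: sum_distrib_left)
    ultimately show ?thesis
      by (simp only: sum_subtractf)
  qed
  finally have "quad_form I c (\<lambda>i j. E (?\<theta> i j)) > 0"
    using small by linarith
  moreover have "quad_form I c (\<lambda>i j. \<phi> (?\<theta> i j)) = quad_form I c (\<lambda>i j. \<psi> (?\<theta> i j)) + quad_form I c (\<lambda>i j. E (?\<theta> i j))"
    unfolding quad_form_add[symmetric] by (simp add: E_def)
  ultimately show ?thesis
    using \<psi>(4) by linarith
qed

section \<open>Strict concavity of the change of variable\<close>

text \<open>The quotient \<open>arctan w / w\<close> strictly decreases, because the derivative of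
  \<open>arctan\<close> does: compare mean values over the intervals from 0 to \<open>w\<close> and
  from \<open>w\<close> to \<open>w'\<close>.\<close>

lemma arctan_secant_less:
  assumes "0 < w" "w < w'"
  shows "w * arctan w' < w' * arctan w"
proof -
  obtain \<xi> where \<xi>: "0 < \<xi>" "\<xi> < w" "arctan w - arctan 0 = (w - 0) * inverse (1 + \<xi>\<^sup>2)"
    using MVT2[OF assms(1), of arctan "\<lambda>x. inverse (1 + x\<^sup>2)"] DERIV_arctan by blast
  obtain \<zeta> where \<zeta>: "w < \<zeta>" "\<zeta> < w'" "arctan w' - arctan w = (w' - w) * inverse (1 + \<zeta>\<^sup>2)"
    using MVT2[OF assms(2), of arctan "\<lambda>x. inverse (1 + x\<^sup>2)"] DERIV_arctan by blast
  have "\<xi>\<^sup>2 < \<zeta>\<^sup>2"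
    using \<xi> \<zeta> by (intro power_strict_mono) auto
  then have "inverse (1 + \<zeta>\<^sup>2) < inverse (1 + \<xi>\<^sup>2)"
    by (intro less_imp_inverse_less) (auto simp: add_pos_nonneg)
  then have "w * ((w' - w) * inverse (1 + \<zeta>\<^sup>2)) < w * ((w' - w) * inverse (1 + \<xi>\<^sup>2))"
    using assms by (intro mult_strict_left_mono) auto
  moreover have "w * arctan w' = w * arctan w + w * ((w' - w) * inverse (1 + \<zeta>\<^sup>2))"
    unfolding \<zeta>(3)[symmetric] by (simp add: right_diff_distrib)
  moreover have "w' * arctan w = w * arctan w + w * ((w' - w) * inverse (1 + \<xi>\<^sup>2))"
    using \<xi>(3) by (simp add: algebra_simps)
  ultimately show ?thesis by simp
qed

text \<open>The derivative is a product of two positive strictly decreasing factors,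
  \<open>arctan (sqrt u) / sqrt u\<close> and \<open>1 / (1 + u)\<close>, up to the constant
  4.\<close>

lemma two_arctan_sqrt_sq_strict_concave:
  fixes F :: "real \<Rightarrow> real"
  defines "F \<equiv> \<lambda>u. (2 * arctan (sqrt u))\<^sup>2"
  assumes "0 < u" "u < p" "p < v"
  shows "(F v - F p) * (p - u) < (F p - F u) * (v - p)"
proof -
  define F' where "F' = (\<lambda>u. 4 * (arctan (sqrt u) / sqrt u) * (1 / (1 + u)))"
  have D: "(F has_real_derivative F' t) (at t)" if "t > 0" for t
    unfolding F_def F'_def using that
    by (auto intro!: derivative_eq_intros simp: divide_simps)
  obtain \<xi> where \<xi>: "u < \<xi>" "\<xi> < p" "F p - F u = (p - u) * F' \<xi>"
    using MVT2[of u p F F'] D assms by force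
  obtain \<zeta> where \<zeta>: "p < \<zeta>" "\<zeta> < v" "F v - F p = (v - p) * F' \<zeta>"
    using MVT2[of p v F F'] D assms by force
  have "sqrt \<xi> * arctan (sqrt \<zeta>) < sqrt \<zeta> * arctan (sqrt \<xi>)"
    using \<xi> \<zeta> assms by (intro arctan_secant_less) auto
  then have "arctan (sqrt \<zeta>) / sqrt \<zeta> < arctan (sqrt \<xi>) / sqrt \<xi>"
    using \<xi> \<zeta> assms by (simp add: field_simps)
  moreover have "1 / (1 + \<zeta>) < 1 / (1 + \<xi>)"
    using \<xi> \<zeta> assms by (intro divide_strict_left_mono) auto
  moreover have "arctan (sqrt \<zeta>) / sqrt \<zeta> > 0"
    using \<zeta> assms by (simp add: zero_less_arctan_iff)
  moreover have "arctan (sqrt \<xi>) / sqrt \<xi> > 0"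
    using \<xi> assms by (simp add: zero_less_arctan_iff)
  ultimately have "arctan (sqrt \<zeta>) / sqrt \<zeta> * (1 / (1 + \<zeta>)) < arctan (sqrt \<xi>) / sqrt \<xi> * (1 / (1 + \<xi>))"
    using \<zeta> assms by (intro mult_strict_mono) auto
  then have "F' \<zeta> < F' \<xi>"
    by (simp add: F'_def)
  then have "((v - p) * (p - u)) * F' \<zeta> < ((v - p) * (p - u)) * F' \<xi>"
    using assms by (intro mult_strict_left_mono) auto
  then show ?thesis
    unfolding \<xi>(3) \<zeta>(3) by (simp add: mult_ac)
qed

section \<open>Consequences of convexity and decay\<close>

text \<open>Far out \<open>\<phi>\<close> is below \<open>\<delta> / 2\<close> in size, so its mean
  slope over an interval of length 1 is below \<open>\<delta>\<close>.\<close>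

lemma small_derivative_at_top:
  fixes \<phi> \<phi>' :: "real \<Rightarrow> real"
  assumes lim: "(\<phi> \<longlongrightarrow> 0) at_top"
    and deriv: "\<And>t. t > 0 \<Longrightarrow> (\<phi> has_real_derivative \<phi>' t) (at t)"
    and \<delta>: "\<delta> > 0"
  obtains \<xi> where "\<xi> > T" "\<xi> > 0" "\<bar>\<phi>' \<xi>\<bar> < \<delta>"
proof -
  have "eventually (\<lambda>t. \<bar>\<phi> t\<bar> < \<delta> / 2) at_top"
    using tendstoD[OF lim, of "\<delta> / 2"] \<delta> by (simp add: dist_real_def)
  then obtain N where N: "\<And>t. t \<ge> N \<Longrightarrow> \<bar>\<phi> t\<bar> < \<delta> / 2"
    by (auto simp: eventually_at_top_linorder)
  define t where "t = max N (max T 1)"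
  obtain \<xi> where \<xi>: "t < \<xi>" "\<xi> < t + 1" "\<phi> (t + 1) - \<phi> t = (t + 1 - t) * \<phi>' \<xi>"
    using MVT2[of t "t + 1" \<phi> \<phi>'] deriv by (force simp: t_def)
  have "\<bar>\<phi> (t + 1)\<bar> < \<delta> / 2" "\<bar>\<phi> t\<bar> < \<delta> / 2"
    by (intro N; simp add: t_def)+
  then have "\<bar>\<phi>' \<xi>\<bar> < \<delta>"
    using \<xi>(3) by simp
  moreover have "\<xi> > T" "\<xi> > 0"
    using \<xi>(1) by (auto simp: t_def)
  ultimately show ?thesis by (rule that[rotated 2])
qed

text \<open>If the convex \<open>g\<close> increased somewhere, it would grow at least linearly, yet
  it comes arbitrarily close to 0 arbitrarily far out. This gives monotonicity and then the sign.
  Moreover \<open>g\<close> is not constant, as otherwise \<open>\<phi>\<close> would be, and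
  convexity carries one strict drop after \<open>s1\<close> back to all smaller arguments.\<close>

lemma convex_vanishing_derivative:
  fixes \<phi> \<phi>' :: "real \<Rightarrow> real"
  defines "g \<equiv> \<lambda>t. - \<phi>' (sqrt t)"
  assumes lim: "(\<phi> \<longlongrightarrow> 0) at_top"
    and deriv: "\<forall>t>0. (\<phi> has_real_derivative \<phi>' t) (at t)"
    and conv: "convex_on {0<..} g"
  shows "antimono_on {0<..} g"
    and "\<And>s. 0 < s \<Longrightarrow> 0 \<le> g s"
    and "\<lbrakk>continuous_on {0..} \<phi>; \<phi> 0 \<noteq> 0\<rbrakk> \<Longrightarrow> \<exists>s1>0. \<forall>s t. 0 < s \<longrightarrow> s < t \<longrightarrow> t \<le> s1 \<longrightarrow> g t < g s"
proof -
  have small: "\<exists>v>S. \<bar>g v\<bar> < \<delta>" if \<delta>: "\<delta> > 0" for S \<delta>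
  proof -
    obtain \<xi> where \<xi>: "\<xi> > max S 1" "\<xi> > 0" "\<bar>\<phi>' \<xi>\<bar> < \<delta>"
      by (rule small_derivative_at_top[OF lim _ \<delta>]) (use deriv in blast)+
    have "\<xi> * 1 \<le> \<xi> * \<xi>"
      using \<xi> by (intro mult_left_mono) auto
    then have "\<xi>\<^sup>2 > S"
      using \<xi>(1) unfolding power2_eq_square by linarith
    moreover have "\<bar>g (\<xi>\<^sup>2)\<bar> < \<delta>"
      using \<xi> by (simp add: g_def)
    ultimately show ?thesis by blast
  qed
  have anti: "g t \<le> g s" if "0 < s" "s \<le> t" for s t
  proof (rule ccontr)
    assume "\<not> g t \<le> g s"
    then have lt: "g s < g t" and st: "s < t"
      using that by (auto simp: less_le)
    define k where "k = (g t - g s) / (t - s)"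
    have k: "k > 0" using lt st by (simp add: k_def)
    \<comment> \<open>So far out that the line through the values at \<open>s\<close> and
      \<open>t\<close>, of slope \<open>k\<close>, exceeds 1; convexity puts \<open>g v\<close>
      above it.\<close>
    obtain v where v: "v > t + \<bar>1 - g t\<bar> / k" "\<bar>g v\<bar> < 1"
      using small[of 1] by auto
    have vt: "\<bar>1 - g t\<bar> < k * (v - t)"
      using v(1) k by (simp add: field_simps)
    have "v > t"
      using v(1) k by (smt (verit) divide_nonneg_pos abs_ge_zero)
    then have "(g t - g v) * (t - s) \<le> (g s - g t) * (v - t)"
      using that st by (intro convex_on_three_points[OF conv]) auto
    also have "\<dots> = - (k * (v - t)) * (t - s)"
      using st by (simp add: k_def field_simps)
    finally have "g t - g v \<le> - (k * (v - t))"
      using st by (subst (asm) mult_le_cancel_right_pos) auto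
    then show False
      using vt v(2) by linarith
  qed
  then show "antimono_on {0<..} g"
    by (intro monotone_onI) auto
  show "0 \<le> g s" if "0 < s" for s
  proof (rule ccontr)
    assume "\<not> 0 \<le> g s"
    then obtain v where v: "v > s" "\<bar>g v\<bar> < - g s"
      using small[of "- g s" s] by auto
    then show False
      using anti[of s v] that by simp
  qed
  assume cont: "continuous_on {0..} \<phi>" and \<phi>0: "\<phi> 0 \<noteq> 0"
  have "\<exists>s1 s2. 0 < s1 \<and> s1 < s2 \<and> g s2 < g s1"
  proof (rule ccontr)
    assume "\<not> ?thesis"
    then have const: "g t = g s" if "0 < s" "s < t" for s t
      using that anti[of s t] by (metis less_le order.antisym not_le)
    \<comment> \<open>A constant that is arbitrarily small in size is 0, so \<open>\<phi>\<close>
      keeps its initial value, against its limit 0.\<close>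
    have zero: "g s = 0" if "s > 0" for s
    proof (rule ccontr)
      assume "g s \<noteq> 0"
      then obtain v where "v > s" "\<bar>g v\<bar> < \<bar>g s\<bar>"
        using small[of "\<bar>g s\<bar>" s] by auto
      with const[of s v] that show False by simp
    qed
    have "\<phi> t = \<phi> 0" if "t > 0" for t
    proof (rule DERIV_isconst_end[OF that])
      show "continuous_on {0..t} \<phi>"
        by (rule continuous_on_subset[OF cont]) auto
      show "(\<phi> has_real_derivative 0) (at x)" if "0 < x" "x < t" for x
        using deriv[rule_format, OF that(1)] zero[of "x\<^sup>2"] that by (simp add: g_def)
    qed
    then have "eventually (\<lambda>t. \<phi> t = \<phi> 0) at_top"
      unfolding eventually_at_top_linorder by (intro exI[of _ 1]) auto
    then have "(\<phi> \<longlongrightarrow> \<phi> 0) at_top"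
      by (rule tendsto_eventually)
    then have "\<phi> 0 = 0"
      using tendsto_unique[OF _ _ lim] by force
    with \<phi>0 show False ..
  qed
  then obtain s1 s2 where s: "0 < s1" "s1 < s2" "g s2 < g s1" by blast
  have "g t < g r" if "0 < r" "r < t" "t \<le> s1" for r t
  proof (rule ccontr)
    assume "\<not> g t < g r"
    then have eq: "g t = g r"
      using anti[of r t] that by simp
    have "(g t - g s2) * (t - r) \<le> (g r - g t) * (s2 - t)"
      using that s by (intro convex_on_three_points[OF conv]) auto
    moreover have "g t - g s2 > 0"
      using anti[of t s1] that s by simp
    then have "(g t - g s2) * (t - r) > 0"
      using that by simp
    ultimately show False
      by (simp add: eq)
  qed
  with s show "\<exists>s1>0. \<forall>s t. 0 < s \<longrightarrow> s < t \<longrightarrow> t \<le> s1 \<longrightarrow> g t < g s"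
    by blast
qed

text \<open>\<open>G\<close> at a mean is at most \<open>g\<close> at the mean of the values of
  \<open>F\<close>, since \<open>F\<close> is concave and \<open>g\<close> nonincreasing, and this
  is at most the mean of \<open>G\<close> by convexity of \<open>g\<close>. The first inequality is
  strict where \<open>g\<close> strictly decreases.\<close>

lemma convex_comp_two_arctan_sqrt_sq:
  fixes g :: "real \<Rightarrow> real"
  defines "G \<equiv> \<lambda>u. g ((2 * arctan (sqrt u))\<^sup>2)"
  assumes conv: "convex_on {0<..} g"
    and antimono: "antimono_on {0<..} g"
  shows "convex_on {0<..} G"
    and "antimono_on {0<..} G"
    and "\<lbrakk>s1 > 0; \<And>s t. 0 < s \<Longrightarrow> s < t \<Longrightarrow> t \<le> s1 \<Longrightarrow> g t < g s\<rbrakk> \<Longrightarrow>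
      \<exists>u1>0. \<forall>u p v. 0 < u \<longrightarrow> u < p \<longrightarrow> p < v \<longrightarrow> v \<le> u1 \<longrightarrow> (G p - G v) * (p - u) < (G u - G p) * (v - p)"
proof -
  have anti: "g t \<le> g s" if "0 < s" "s \<le> t" for s t
    using monotone_onD[OF antimono, of s t] that by simp
  define F where "F = (\<lambda>u. (2 * arctan (sqrt u))\<^sup>2)"
  have G: "G u = g (F u)" for u by (simp add: G_def F_def)
  have F_pos: "F u > 0" if "u > 0" for u
    using arctan_sqrt_bounds[OF that] by (simp add: F_def)
  have F_mono: "F u \<le> F v" if "0 < u" "u \<le> v" for u v
    unfolding F_def using that arctan_sqrt_bounds[of u]
    by (intro power_mono) (auto simp: arctan_le_iff)
  have mix: "(1 - t) * F u + t * F v < F p"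
    if "0 < u" "u < v" "0 < t" "t < 1" "p = (1 - t) * u + t * v" for t u v p
  proof -
    have pu: "p - u = t * (v - u)" and vp: "v - p = (1 - t) * (v - u)"
      using that by (simp_all add: algebra_simps)
    have "0 < t * (v - u)" "0 < (1 - t) * (v - u)"
      using that by simp_all
    then have "(F v - F p) * (p - u) < (F p - F u) * (v - p)"
      unfolding F_def using that(1) pu vp by (intro two_arctan_sqrt_sq_strict_concave) linarith+
    then have "(F v - F p) * t * (v - u) < (F p - F u) * (1 - t) * (v - u)"
      unfolding pu vp by (simp only: mult.assoc)
    then have "(F v - F p) * t < (F p - F u) * (1 - t)"
      using that by (subst (asm) mult_less_cancel_right_pos) auto
    then show ?thesis by (simp add: algebra_simps)
  qed
  have mix_pos: "(1 - t) * F u + t * F v > 0" if "0 < u" "u < v" "0 < t" "t < 1" for t u v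
    using that F_pos by (intro add_pos_pos mult_pos_pos) auto
  have g_mix: "g ((1 - t) * F u + t * F v) \<le> (1 - t) * G u + t * G v" if "0 < u" "u < v" "0 < t" "t < 1" for t u v
    using convex_onD[OF conv, of t "F u" "F v"] that F_pos by (simp add: G)
  show "convex_on {0<..} G"
  proof (rule convex_on_linorderI)
    fix t u v :: real
    assume t: "0 < t" "t < 1" and uv: "u \<in> {0<..}" "v \<in> {0<..}" "u < v"
    have "G ((1 - t) * u + t * v) \<le> g ((1 - t) * F u + t * F v)"
      unfolding G using mix[OF _ _ t refl, of u v] mix_pos[OF _ _ t, of u v] uv by (intro anti) auto
    also have "\<dots> \<le> (1 - t) * G u + t * G v"
      using t uv by (intro g_mix) auto
    finally show "G ((1 - t) *\<^sub>R u + t *\<^sub>R v) \<le> (1 - t) * G u + t * G v"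
      by simp
  qed simp
  show "antimono_on {0<..} G"
    unfolding G by (intro monotone_onI anti) (auto intro: F_pos F_mono)
  assume s1: "s1 > 0" and strict: "\<And>s t. 0 < s \<Longrightarrow> s < t \<Longrightarrow> t \<le> s1 \<Longrightarrow> g t < g s"
  \<comment> \<open>With \<open>F u1 = m\<^sup>2 \<le> s1\<close>, the values of \<open>F\<close> up
    to \<open>u1\<close> stay where \<open>g\<close> strictly decreases; the bound 1 keeps
    \<open>m / 2\<close> below \<open>pi / 2\<close>.\<close>
  define m where "m = min (sqrt s1) 1"
  define u1 where "u1 = (tan (m / 2))\<^sup>2"
  have m: "0 < m" "m \<le> 1" "m\<^sup>2 \<le> s1"
    using s1 power_mono[of m "sqrt s1" 2] by (auto simp: m_def)
  then have m_pi: "m / 2 < pi / 2"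
    using pi_gt3 by simp
  then have tan: "tan (m / 2) > 0"
    using m by (intro tan_gt_zero) auto
  then have u1: "u1 > 0" by (simp add: u1_def)
  have "arctan (tan (m / 2)) = m / 2"
    using m m_pi by (intro arctan_tan) auto
  then have "2 * arctan (sqrt u1) = m"
    using tan by (simp add: u1_def)
  then have Fu1: "F u1 = m\<^sup>2"
    by (simp only: F_def)
  have "(G p - G v) * (p - u) < (G u - G p) * (v - p)" if "0 < u" "u < p" "p < v" "v \<le> u1" for u p v
  proof -
    define t where "t = (p - u) / (v - u)"
    have t: "0 < t" "t < 1" using that by (auto simp: t_def)
    have pu: "p - u = t * (v - u)"
      using that by (simp add: t_def)
    then have p: "p = (1 - t) * u + t * v" and vp: "v - p = (1 - t) * (v - u)"
      by (simp_all add: algebra_simps)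
    have "F p \<le> s1"
      using F_mono[of p u1] that Fu1 m by simp
    then have "G p < g ((1 - t) * F u + t * F v)"
      unfolding G using mix[OF _ _ t p] mix_pos[OF _ _ t, of u v] that by (intro strict) auto
    also have "\<dots> \<le> (1 - t) * G u + t * G v"
      using t that by (intro g_mix) auto
    finally have "(G p - G v) * t < (G u - G p) * (1 - t)"
      by (simp add: algebra_simps)
    then have "(G p - G v) * t * (v - u) < (G u - G p) * (1 - t) * (v - u)"
      using that by (intro mult_strict_right_mono) auto
    then show ?thesis
      unfolding pu vp by (simp only: mult.assoc)
  qed
  with u1 show "\<exists>u1>0. \<forall>u p v. 0 < u \<longrightarrow> u < p \<longrightarrow> p < v \<longrightarrow> v \<le> u1 \<longrightarrow> (G p - G v) * (p - u) < (G u - G p) * (v - p)"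
    by blast
qed

section \<open>Membership of the restricted function in the class\<close>

theorem theorem5:
  fixes \<phi> \<phi>' :: "real \<Rightarrow> real"
  assumes "continuous_on {0..} \<phi>"
    and "\<phi> 0 = 1"
    and "(\<phi> \<longlongrightarrow> 0) at_top"
    and "\<And>t. t > 0 \<Longrightarrow> (\<phi> has_real_derivative \<phi>' t) (at t)"
    and "continuous_on {0<..} \<phi>'"
    and "convex_on {0<..} (\<lambda>t. - \<phi>' (sqrt t))"
  shows "restrict \<phi> {0..pi} \<in> Psi_plus TYPE(real ^ 4)"
proof -
  define g where "g = (\<lambda>t. - \<phi>' (sqrt t))"
  have conv: "convex_on {0<..} g"
    using assms(6) by (simp add: g_def)
  have deriv': "\<forall>t>0. (\<phi> has_real_derivative \<phi>' t) (at t)"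
    using assms(4) by blast
  note vd = convex_vanishing_derivative[OF assms(3) deriv' assms(6)]
  have g_antimono: "antimono_on {0<..} g"
    unfolding g_def by (rule vd(1))
  have g_nonneg: "0 \<le> g s" if "0 < s" for s
    unfolding g_def by (rule vd(2)[OF that])
  have "\<exists>s1>0. \<forall>s t. 0 < s \<longrightarrow> s < t \<longrightarrow> t \<le> s1 \<longrightarrow> g t < g s"
    unfolding g_def by (rule vd(3)[OF assms(1)]) (simp add: assms(2))
  then obtain s1 where s1: "s1 > 0" "\<And>s t. 0 < s \<Longrightarrow> s < t \<Longrightarrow> t \<le> s1 \<Longrightarrow> g t < g s"
    by blast
  define G where "G = (\<lambda>u. g ((2 * arctan (sqrt u))\<^sup>2))"
  note comp = convex_comp_two_arctan_sqrt_sq[OF conv g_antimono]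
  have G_conv: "convex_on {0<..} G" and G_antimono: "antimono_on {0<..} G"
    unfolding G_def by (rule comp)+
  have "\<exists>u1>0. \<forall>u p v. 0 < u \<longrightarrow> u < p \<longrightarrow> p < v \<longrightarrow> v \<le> u1 \<longrightarrow> (G p - G v) * (p - u) < (G u - G p) * (v - p)"
    unfolding G_def by (rule comp(3)[OF s1])
  then obtain u1 where u1: "u1 > 0"
    "\<And>u p v. 0 < u \<Longrightarrow> u < p \<Longrightarrow> p < v \<Longrightarrow> v \<le> u1 \<Longrightarrow> (G p - G v) * (p - u) < (G u - G p) * (v - p)"
    by blast
  have G_anti: "G v \<le> G u" if "0 < u" "u \<le> v" for u v
    using monotone_onD[OF G_antimono, of u v] that by simp
  have G_nonneg: "0 \<le> G u" if "0 < u" for u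
    unfolding G_def using arctan_sqrt_bounds[OF that] by (intro g_nonneg) simp
  \<comment> \<open>For \<open>u = (tan (\<theta> / 2))\<^sup>2\<close> the inner function of
    \<open>G\<close> takes the value \<open>\<theta>\<^sup>2\<close>, and the root inside
    \<open>g\<close> returns \<open>\<theta>\<close>.\<close>
  have deriv: "(\<phi> has_real_derivative - G ((tan (\<theta> / 2))\<^sup>2)) (at \<theta>)" if "0 < \<theta>" "\<theta> < pi" for \<theta>
  proof -
    have "tan (\<theta> / 2) > 0" using that by (intro tan_gt_zero) auto
    moreover have "arctan (tan (\<theta> / 2)) = \<theta> / 2"
      using that by (intro arctan_tan) auto
    ultimately have "2 * arctan (sqrt ((tan (\<theta> / 2))\<^sup>2)) = \<theta>"
      by simp
    then have "- G ((tan (\<theta> / 2))\<^sup>2) = \<phi>' \<theta>"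
      unfolding G_def g_def using that by (simp only:) simp
    then show ?thesis using assms(4)[OF that(1)] by simp
  qed
  have cont: "continuous_on {0..pi} \<phi>"
    by (rule continuous_on_subset[OF assms(1)]) auto
  \<comment> \<open>Beyond \<open>pi\<close> the function does not increase and tends to 0. Its
    value at \<open>pi\<close> serves as the additive constant of the approximant and must therefore
    be nonnegative.\<close>
  have \<phi>pi: "\<phi> pi \<ge> 0"
  proof (rule tendsto_upperbound[OF assms(3)])
    have "\<phi> t \<le> \<phi> pi" if "t \<ge> pi" for t
    proof (rule DERIV_nonpos_imp_nonincreasing[OF that])
      fix x assume "pi \<le> x"
      then have x: "x > 0" using pi_gt_zero by linarith
      then have "\<phi>' x \<le> 0"
        using g_nonneg[of "x\<^sup>2"] by (simp add: g_def)
      with assms(4)[OF x] show "\<exists>y. (\<phi> has_real_derivative y) (at x) \<and> y \<le> 0" by blast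
    qed
    then show "eventually (\<lambda>t. \<phi> t \<le> \<phi> pi) at_top"
      by (auto simp: eventually_at_top_linorder)
  qed simp
  have "strictly_positive_definite_on (sphere (0 :: real ^ 4) 1) (\<lambda>x y. restrict \<phi> {0..pi} (great_circle_dist x y))"
    unfolding strictly_positive_definite_on_def
  proof (intro allI impI)
    fix n :: nat and x :: "nat \<Rightarrow> real ^ 4" and c :: "nat \<Rightarrow> real"
    assume A: "x ` {1..n} \<subseteq> sphere 0 1 \<and> inj_on x {1..n}"
    let ?S = "\<Sum>i=1..n. \<Sum>j=1..n. c i * c j * restrict \<phi> {0..pi} (great_circle_dist (x i) (x j))"
    have x: "norm (x i) = 1" if "i \<in> {1..n}" for i
      using A that by (auto simp: image_subset_iff)
    \<comment> \<open>All angles between points of the sphere lie in the interval from 0 to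
      \<open>pi\<close>, where the restriction agrees with \<open>\<phi>\<close>.\<close>
    have eq: "?S = quad_form {1..n} c (\<lambda>i j. \<phi> (arccos (x i \<bullet> x j)))"
      unfolding quad_form_def
    proof (intro sum.cong refl)
      fix i j assume "i \<in> {1..n}" "j \<in> {1..n}"
      then have "arccos (x i \<bullet> x j) \<in> {0..pi}"
        by (intro arccos_inner_mem x)
      then show "c i * c j * restrict \<phi> {0..pi} (great_circle_dist (x i) (x j)) = c i * c j * \<phi> (arccos (x i \<bullet> x j))"
        by (simp add: great_circle_dist_def)
    qed
    have pos: "?S > 0" if "\<exists>i\<in>{1..n}. c i \<noteq> 0"
    proof -
      from that obtain i where i: "i \<in> {1..n}" "c i \<noteq> 0" by blast
      show ?thesis
        unfolding eq
      proof (rule quad_form_pos_of_convex[where G = G and ?u1.0 = u1 and ?i0.0 = i])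
        show "finite {1..n}" "inj_on x {1..n}" using A by auto
      qed (rule x i cont \<phi>pi deriv G_conv G_anti G_nonneg u1; assumption)+
    qed
    have zero: "?S = 0" if "\<not> (\<exists>i\<in>{1..n}. c i \<noteq> 0)"
      using that by (intro sum.neutral ballI) auto
    show "?S \<ge> 0 \<and> ((\<exists>i\<in>{1..n}. c i \<noteq> 0) \<longrightarrow> ?S > 0)"
    proof (cases "\<exists>i\<in>{1..n}. c i \<noteq> 0")
      case True
      then show ?thesis using pos[OF True] by (intro conjI impI less_imp_le)
    next
      case False
      then show ?thesis by (simp only: zero[OF False] order.refl simp_thms)
    qed
  qed
  moreover have "continuous_on {0..pi} (restrict \<phi> {0..pi})"
    by (rule continuous_on_eq[OF cont]) simp
  moreover have "restrict \<phi> {0..pi} 0 = 1"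
    using assms(2) by simp
  ultimately show ?thesis
    by (simp add: Psi_plus_def del: restrict_apply)
qed

end
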